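(* Let $p$ and $q$ be distinct primes with $pq\neq 6$ and $q^2\mid p-1$. Let $r$ be an integer whose multiplicative order modulo $p$ is $q^{2}$, and let $G=\langle a,b,c\mid a^{q^{2}}=b^{p}=c^{p}=[b,c]=1,\ a^{-1}ba=b^{r},\ a^{-1}ca=c^{r}\rangle$. Then $\mathrm{Aut}(G)\simeq(\mathbb{Z}_{p}\times\mathbb{Z}_{p})\rtimes GL(2,p)$.
   Context: $\mathbb{Z}_n$ is the cyclic group of order $n$; $[x,y]=x^{-1}y^{-1}xy$. $X\rtimes Y$ denotes a semidirect product with normal subgroup $X$ with respect to some homomorphism $Y\to\mathrm{Aut}(X)$; the statement asserts that $\mathrm{Aut}(G)$ is isomorphic to such a semidirect product for some choice of action. *)

theory Defs
  imports
    "HOL-Algebra.Bij"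
    "HOL-Algebra.Elementary_Groups"
    "HOL-Number_Theory.Number_Theory"
    "Jordan_Normal_Form.Matrix"
begin

section \<open>Free groups and presentations\<close>

text \<open>A letter \<open>(x, True)\<close> stands for the generator \<open>x\<close>, and \<open>(x, False)\<close> for its
  formal inverse.\<close>

type_synonym 'g word = "('g \<times> bool) list"

inductive cancels :: "'g word \<Rightarrow> 'g word \<Rightarrow> bool" where
  "cancels (u @ [(x, e), (x, \<not> e)] @ v) (u @ v)"

definition free_equiv :: "('g word \<times> 'g word) set" where
  "free_equiv = {(u, v). equivclp cancels u v}"

definition free_group :: "'g word set monoid" where
  "free_group =
    \<lparr>carrier = UNIV // free_equiv,
     monoid.mult = (\<lambda>A B. \<Union>u\<in>A. \<Union>v\<in>B. free_equiv `` {u @ v}),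
     one = free_equiv `` {[]}\<rparr>"

definition free_gen :: "'g \<Rightarrow> 'g word set" where
  "free_gen x = free_equiv `` {[(x, True)]}"

definition normal_closure :: "('a, 'b) monoid_scheme \<Rightarrow> 'a set \<Rightarrow> 'a set" where
  "normal_closure G S = \<Inter>{N. N \<lhd> G \<and> S \<subseteq> N}"

text \<open>The group with all elements of \<open>'g\<close> as generators and the elements of \<open>R\<close> as relators.\<close>

definition presented_group :: "'g word set set \<Rightarrow> 'g word set set monoid" where
  "presented_group R = free_group Mod normal_closure free_group R"

definition commutator :: "('a, 'b) monoid_scheme \<Rightarrow> 'a \<Rightarrow> 'a \<Rightarrow> 'a" where
  "commutator G x y = inv\<^bsub>G\<^esub> x \<otimes>\<^bsub>G\<^esub> inv\<^bsub>G\<^esub> y \<otimes>\<^bsub>G\<^esub> x \<otimes>\<^bsub>G\<^esub> y"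

datatype generator = Gen_a | Gen_b | Gen_c

text \<open>A relation \<open>u = v\<close> is encoded by the relator \<open>u v\<^sup>-\<^sup>1\<close>.\<close>

definition the_group :: "nat \<Rightarrow> nat \<Rightarrow> int \<Rightarrow> generator word set set monoid" where
  "the_group p q r =
    (let F = free_group; a = free_gen Gen_a; b = free_gen Gen_b; c = free_gen Gen_c
     in presented_group
          {a [^]\<^bsub>F\<^esub> (q\<^sup>2),
           b [^]\<^bsub>F\<^esub> p,
           c [^]\<^bsub>F\<^esub> p,
           commutator F b c,
           (inv\<^bsub>F\<^esub> a \<otimes>\<^bsub>F\<^esub> b \<otimes>\<^bsub>F\<^esub> a) \<otimes>\<^bsub>F\<^esub> inv\<^bsub>F\<^esub> (b [^]\<^bsub>F\<^esub> r),
           (inv\<^bsub>F\<^esub> a \<otimes>\<^bsub>F\<^esub> c \<otimes>\<^bsub>F\<^esub> a) \<otimes>\<^bsub>F\<^esub> inv\<^bsub>F\<^esub> (c [^]\<^bsub>F\<^esub> r)})"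


section \<open>Semidirect products\<close>

definition semidirect_product ::
    "('a, 'm) monoid_scheme \<Rightarrow> ('b, 'n) monoid_scheme \<Rightarrow> ('b \<Rightarrow> 'a \<Rightarrow> 'a) \<Rightarrow> ('a \<times> 'b) monoid" where
  "semidirect_product N H \<theta> =
    \<lparr>carrier = carrier N \<times> carrier H,
     monoid.mult = (\<lambda>(x, y) (x', y'). (x \<otimes>\<^bsub>N\<^esub> \<theta> y x', y \<otimes>\<^bsub>H\<^esub> y')),
     one = (\<one>\<^bsub>N\<^esub>, \<one>\<^bsub>H\<^esub>)\<rparr>"


section \<open>General linear groups\<close>

text \<open>The matrix operations of \<open>Jordan_Normal_Form\<close> are those of an arithmetic type class, while the
  field with \<open>p\<close> elements is a ring record here, so the product is spelled out.\<close>

definition matrix_monoid :: "nat \<Rightarrow> ('a, 'b) ring_scheme \<Rightarrow> 'a mat monoid" where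
  "matrix_monoid n R =
    \<lparr>carrier = {A \<in> carrier_mat n n. elements_mat A \<subseteq> carrier R},
     monoid.mult = (\<lambda>A B. mat n n (\<lambda>(i, j). \<Oplus>\<^bsub>R\<^esub>k\<in>{..<n}. A $$ (i, k) \<otimes>\<^bsub>R\<^esub> B $$ (k, j))),
     one = mat n n (\<lambda>(i, j). if i = j then \<one>\<^bsub>R\<^esub> else \<zero>\<^bsub>R\<^esub>)\<rparr>"

definition GL :: "nat \<Rightarrow> nat \<Rightarrow> int mat monoid" where
  "GL n p = units_of (matrix_monoid n (residue_ring (int p)))"

end

theory Submission
  imports Defs
begin

text \<open>
  The relations say that \<open>b\<close> and \<open>c\<close> span a plane \<open>V\<close> over the field with \<open>p\<close> elements, on which
  \<open>a\<close>, of order \<open>n = q^2\<close>, acts by conjugation as a scalar: \<open>a v a^-1 = s v\<close>, with \<open>s\<close> the inverse of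
  \<open>r\<close> modulo \<open>p\<close>. Thus the group is the semidirect product of \<open>V\<close> with a cyclic group of order \<open>n\<close>
  (\<open>presented_group_iso_extension\<close>); that the presentation does not collapse follows by mapping it onto this
  model.

  An automorphism preserves \<open>V\<close>, because \<open>p\<close> and \<open>n\<close> are coprime, and it induces on \<open>V\<close> an element \<open>A\<close>
  of \<open>GL(2, p)\<close> (\<open>gl_action_iso\<close>). Modulo \<open>V\<close> it must fix \<open>a\<close>: scalars commute with \<open>A\<close>, so the image of
  \<open>a\<close> acts on \<open>V\<close> by the same scalar \<open>s\<close>, and the powers \<open>s^l\<close> with \<open>0 \<le> l < n\<close> are distinct. Hence
  \<open>a\<close> goes to \<open>u a\<close> for some \<open>u\<close> in \<open>V\<close>. Conversely, every pair \<open>(u, A)\<close> occurs: \<open>s\<close> is not \<open>1\<close>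
  modulo \<open>p\<close>, so \<open>u = (1 - s) w\<close> for a unique \<open>w\<close>, and \<open>A\<close> followed by conjugation by \<open>w\<close> is the
  required automorphism. In terms of the pairs \<open>(w, A)\<close> composition reads
  \<open>(w, A) (w', A') = (w + A w', A A')\<close>, so the automorphism group is the semidirect product of \<open>V\<close> with
  \<open>GL(2, p)\<close> for the natural action (\<open>affine_iso\<close>).
\<close>

section \<open>Automorphism groups of isomorphic groups\<close>

lemma restrict_hom:
  assumes "group G" and "f \<in> hom G H"
  shows "restrict f (carrier G) \<in> hom G H"
  using assms by (auto simp: hom_def monoid.m_closed[OF group.is_monoid])

lemma carrier_AutoGroup: "carrier (AutoGroup G) = auto G"
  by (simp add: AutoGroup_def)

lemma mult_AutoGroup:
  "f \<in> auto G \<Longrightarrow> g \<in> auto G \<Longrightarrow> f \<otimes>\<^bsub>AutoGroup G\<^esub> g = compose (carrier G) f g"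
  by (simp add: AutoGroup_def BijGroup_def auto_def)

lemma one_AutoGroup: "\<one>\<^bsub>AutoGroup G\<^esub> = restrict id (carrier G)"
  by (simp add: AutoGroup_def BijGroup_def id_def)

lemma AutoGroup_apply_mult:
  assumes "f \<in> auto G" "g \<in> auto G" "x \<in> carrier G"
  shows "(f \<otimes>\<^bsub>AutoGroup G\<^esub> g) x = f (g x)"
  using assms by (simp add: mult_AutoGroup compose_eq)

lemma auto_iff:
  "f \<in> auto G \<longleftrightarrow> f \<in> hom G G \<and> f \<in> extensional (carrier G) \<and> bij_betw f (carrier G) (carrier G)"
  by (auto simp: auto_def Bij_def)

lemma auto_hom: "f \<in> auto G \<Longrightarrow> f \<in> hom G G"
  by (simp add: auto_iff)

lemma auto_closed: "f \<in> auto G \<Longrightarrow> x \<in> carrier G \<Longrightarrow> f x \<in> carrier G"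
  by (auto simp: auto_iff hom_def)

lemma auto_inj: "f \<in> auto G \<Longrightarrow> inj_on f (carrier G)"
  by (simp add: auto_iff bij_betw_def)

lemma auto_eqI:
  "f \<in> auto G \<Longrightarrow> g \<in> auto G \<Longrightarrow> (\<And>x. x \<in> carrier G \<Longrightarrow> f x = g x) \<Longrightarrow> f = g"
  by (auto simp: auto_iff intro: extensionalityI)

text \<open>Elements of \<open>AutoGroup\<close> are extensional functions, hence the restriction.\<close>

lemma conjugate_auto:
  assumes "group G" "group H" and hk: "group_isomorphisms G H h k" and f: "f \<in> auto G"
  shows "restrict (h \<circ> f \<circ> k) (carrier H) \<in> auto H"
proof -
  have h: "bij_betw h (carrier G) (carrier H)" and k: "bij_betw k (carrier H) (carrier G)"
    using group_isomorphisms_imp_iso[OF hk]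
      group_isomorphisms_imp_iso[OF group_isomorphisms_sym[OF hk]] by (simp_all add: iso_def)
  have "bij_betw (h \<circ> f \<circ> k) (carrier H) (carrier H)"
    using bij_betw_trans[OF bij_betw_trans[OF k] h] f by (auto simp: auto_iff comp_assoc)
  then have "bij_betw (restrict (h \<circ> f \<circ> k) (carrier H)) (carrier H) (carrier H)"
    by (rule bij_betw_cong[THEN iffD1, rotated]) simp
  moreover have "restrict (h \<circ> f \<circ> k) (carrier H) \<in> hom H H"
    using hk f by (intro restrict_hom[OF assms(2)] Group.hom_compose)
      (auto simp: group_isomorphisms_def auto_iff)
  ultimately show ?thesis
    by (simp add: auto_iff)
qed

lemma conjugate_hom:
  assumes "group G" "group H" and hk: "group_isomorphisms G H h k"
  shows "(\<lambda>f. restrict (h \<circ> f \<circ> k) (carrier H)) \<in> hom (AutoGroup G) (AutoGroup H)"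
proof (rule homI)
  fix f g assume "f \<in> carrier (AutoGroup G)" "g \<in> carrier (AutoGroup G)"
  then have fg: "f \<in> auto G" "g \<in> auto G"
    by (simp_all add: carrier_AutoGroup)
  have k: "k x \<in> carrier G" if "x \<in> carrier H" for x
    using hk that by (auto simp: group_isomorphisms_def hom_def)
  have "k (h y) = y" if "y \<in> carrier G" for y
    using hk that by (simp add: group_isomorphisms_def)
  moreover have "h y \<in> carrier H" if "y \<in> carrier G" for y
    using hk that by (auto simp: group_isomorphisms_def hom_def)
  ultimately show "restrict (h \<circ> (f \<otimes>\<^bsub>AutoGroup G\<^esub> g) \<circ> k) (carrier H) =
      restrict (h \<circ> f \<circ> k) (carrier H) \<otimes>\<^bsub>AutoGroup H\<^esub> restrict (h \<circ> g \<circ> k) (carrier H)"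
    using fg by (auto simp: mult_AutoGroup conjugate_auto[OF assms(1,2) hk] compose_def k auto_closed
        intro!: restrict_ext)
qed (simp add: carrier_AutoGroup conjugate_auto[OF assms(1,2) hk])

lemma conjugate_inverse:
  assumes "group G" "group H" and hk: "group_isomorphisms G H h k" and f: "f \<in> auto G"
  shows "restrict (k \<circ> restrict (h \<circ> f \<circ> k) (carrier H) \<circ> h) (carrier G) = f"
proof (rule auto_eqI)
  show "restrict (k \<circ> restrict (h \<circ> f \<circ> k) (carrier H) \<circ> h) (carrier G) \<in> auto G"
    by (intro conjugate_auto[OF assms(2,1) group_isomorphisms_sym[OF hk]] conjugate_auto[OF assms(1,2) hk] f)
  fix x assume x: "x \<in> carrier G"
  then have "h x \<in> carrier H" "k (h x) = x" "k (h (f x)) = f x"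
    using hk auto_closed[OF f x] by (auto simp: group_isomorphisms_def hom_def)
  then show "restrict (k \<circ> restrict (h \<circ> f \<circ> k) (carrier H) \<circ> h) (carrier G) x = f x"
    using x by simp
qed (fact f)

lemma AutoGroup_cong:
  assumes "group G" "group H" and "G \<cong> H"
  shows "AutoGroup G \<cong> AutoGroup H"
proof -
  obtain h where "h \<in> iso G H"
    using assms(3) by (auto simp: is_iso_def)
  then obtain k where hk: "group_isomorphisms G H h k"
    using group.iso_iff_group_isomorphisms[OF assms(1)] by blast
  note kh = group_isomorphisms_sym[OF hk]
  have "group_isomorphisms (AutoGroup G) (AutoGroup H)
      (\<lambda>f. restrict (h \<circ> f \<circ> k) (carrier H)) (\<lambda>f. restrict (k \<circ> f \<circ> h) (carrier G))"
    unfolding group_isomorphisms_def carrier_AutoGroup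
    by (intro conjI ballI conjugate_hom conjugate_inverse hk kh assms)
  then show ?thesis
    by (intro is_isoI group_isomorphisms_imp_iso)
qed

section \<open>Semidirect products\<close>

lemma semidirect_product_simps:
  "carrier (semidirect_product N H \<theta>) = carrier N \<times> carrier H"
  "\<one>\<^bsub>semidirect_product N H \<theta>\<^esub> = (\<one>\<^bsub>N\<^esub>, \<one>\<^bsub>H\<^esub>)"
  "(x, y) \<otimes>\<^bsub>semidirect_product N H \<theta>\<^esub> (x', y') = (x \<otimes>\<^bsub>N\<^esub> \<theta> y x', y \<otimes>\<^bsub>H\<^esub> y')"
  by (simp_all add: semidirect_product_def)

lemma group_semidirect_product:
  assumes "group N" "group H" and \<theta>: "\<theta> \<in> hom H (AutoGroup N)"
  shows "group (semidirect_product N H \<theta>)"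
proof -
  interpret N: group N by fact
  interpret H: group H by fact
  interpret \<theta>: group_hom H "AutoGroup N" \<theta>
    by (intro group_hom.intro group_hom_axioms.intro assms N.AutoGroup)
  have auto: "\<theta> y \<in> auto N" if "y \<in> carrier H" for y
    using \<theta>.hom_closed[OF that] by (simp add: carrier_AutoGroup)
  have closed [simp]: "\<theta> y x \<in> carrier N" if "y \<in> carrier H" "x \<in> carrier N" for x y
    using auto[OF that(1)] that(2) by (rule auto_closed)
  have mult: "\<theta> y (x \<otimes>\<^bsub>N\<^esub> x') = \<theta> y x \<otimes>\<^bsub>N\<^esub> \<theta> y x'"
    if "y \<in> carrier H" "x \<in> carrier N" "x' \<in> carrier N" for x x' y
    using auto_hom[OF auto[OF that(1)]] that by (auto simp: hom_def)
  have comp: "\<theta> (y \<otimes>\<^bsub>H\<^esub> y') x = \<theta> y (\<theta> y' x)"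
    if "y \<in> carrier H" "y' \<in> carrier H" "x \<in> carrier N" for x y y'
    using that by (simp add: AutoGroup_apply_mult auto)
  have one: "\<theta> \<one>\<^bsub>H\<^esub> x = x" if "x \<in> carrier N" for x
    using \<theta>.hom_one that by (simp add: one_AutoGroup)
  have fix_one: "\<theta> y \<one>\<^bsub>N\<^esub> = \<one>\<^bsub>N\<^esub>" if "y \<in> carrier H" for y
    by (rule hom_one[OF auto_hom[OF auto[OF that]] assms(1,1)])
  show ?thesis
  proof (rule groupI)
    fix z assume "z \<in> carrier (semidirect_product N H \<theta>)"
    then obtain x y where z: "z = (x, y)" "x \<in> carrier N" "y \<in> carrier H"
      by (auto simp: semidirect_product_simps)
    show "\<exists>z'\<in>carrier (semidirect_product N H \<theta>).
        z' \<otimes>\<^bsub>semidirect_product N H \<theta>\<^esub> z = \<one>\<^bsub>semidirect_product N H \<theta>\<^esub>"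
      by (rule bexI[of _ "(\<theta> (inv\<^bsub>H\<^esub> y) (inv\<^bsub>N\<^esub> x), inv\<^bsub>H\<^esub> y)"])
        (use z in \<open>auto simp: semidirect_product_simps one fix_one simp del: \<theta>.hom_inv simp flip: mult\<close>)
  qed (auto simp: semidirect_product_simps mult comp one N.m_assoc H.m_assoc
      simp del: \<theta>.hom_mult \<theta>.hom_one)
qed

lemma semidirect_inclusion_left:
  assumes "group N" "group H" and \<theta>: "\<theta> \<in> hom H (AutoGroup N)"
  shows "(\<lambda>x. (x, \<one>\<^bsub>H\<^esub>)) \<in> hom N (semidirect_product N H \<theta>)"
proof -
  interpret N: group N by fact
  interpret H: group H by fact
  have "\<theta> \<one>\<^bsub>H\<^esub> = restrict id (carrier N)"
    using hom_one[OF \<theta> assms(2) N.AutoGroup] by (simp add: one_AutoGroup)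
  then show ?thesis
    by (auto simp: hom_def semidirect_product_simps)
qed

lemma semidirect_inclusion_right:
  assumes "group N" "group H" and \<theta>: "\<theta> \<in> hom H (AutoGroup N)"
  shows "(\<lambda>y. (\<one>\<^bsub>N\<^esub>, y)) \<in> hom H (semidirect_product N H \<theta>)"
proof -
  interpret N: group N by fact
  interpret H: group H by fact
  have "\<theta> y \<one>\<^bsub>N\<^esub> = \<one>\<^bsub>N\<^esub>" if "y \<in> carrier H" for y
  proof -
    have "\<theta> y \<in> auto N"
      using hom_in_carrier[OF \<theta> that] by (simp add: carrier_AutoGroup)
    then show ?thesis
      by (intro hom_one[OF _ assms(1) assms(1)] auto_hom)
  qed
  then show ?thesis
    by (auto simp: hom_def semidirect_product_simps)
qed

lemma semidirect_projection: "snd \<in> hom (semidirect_product N H \<theta>) H"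
  by (auto simp: hom_def semidirect_product_def)

section \<open>Free groups and presented groups\<close>

lemma free_equiv_iff: "(u, v) \<in> free_equiv \<longleftrightarrow> equivclp cancels u v"
  by (simp add: free_equiv_def)

lemma equiv_free_equiv: "equiv UNIV free_equiv"
proof (rule equivI)
  show "refl_on UNIV free_equiv"
    by (simp add: refl_on_def free_equiv_iff)
  show "sym free_equiv"
    unfolding sym_def free_equiv_iff by (blast dest: equivclp_sym)
  show "trans free_equiv"
    unfolding trans_def free_equiv_iff by (blast dest: equivclp_trans)
qed simp

lemma free_equiv_class_eq: "free_equiv `` {u} = free_equiv `` {v} \<longleftrightarrow> equivclp cancels u v"
  by (metis UNIV_I eq_equiv_class_iff equiv_free_equiv free_equiv_iff)

lemma cancels_context: "cancels u v \<Longrightarrow> cancels (x @ u @ y) (x @ v @ y)"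
proof (induction rule: cancels.induct)
  case (1 u z e v)
  show ?case
    using cancels.intros[of "x @ u" z e "v @ y"] by simp
qed

lemma free_equiv_context:
  "equivclp cancels u v \<Longrightarrow> equivclp cancels (x @ u @ y) (x @ v @ y)"
proof (induction rule: equivclp_induct)
  case (step w z)
  then show ?case
    using cancels_context equivclp_into_equivclp[of cancels _ "x @ w @ y" "x @ z @ y"] by blast
qed simp

lemma free_equiv_append:
  assumes "equivclp cancels u u'" "equivclp cancels v v'"
  shows "equivclp cancels (u @ v) (u' @ v')"
  using free_equiv_context[OF assms(1), of "[]" v] free_equiv_context[OF assms(2), of u' "[]"]
  by (simp add: equivclp_trans[of cancels "u @ v" "u' @ v"])

lemma carrier_free_group: "carrier free_group = range (\<lambda>u. free_equiv `` {u})"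
  by (auto simp: free_group_def quotient_def)

lemma class_in_free_group [simp]: "free_equiv `` {u} \<in> carrier free_group"
  by (simp add: carrier_free_group)

lemma free_group_cases:
  assumes "A \<in> carrier free_group"
  obtains u where "A = free_equiv `` {u}"
  using assms unfolding carrier_free_group by (rule imageE)

lemma one_free_group: "\<one>\<^bsub>free_group\<^esub> = free_equiv `` {[]}"
  by (simp add: free_group_def)

lemma mult_free_group:
  "free_equiv `` {u} \<otimes>\<^bsub>free_group\<^esub> free_equiv `` {v} = free_equiv `` {u @ v}"
proof -
  have "(\<Union>u'\<in>free_equiv `` {u}. \<Union>v'\<in>free_equiv `` {v}. free_equiv `` {u' @ v'}) =
      (\<Union>u'\<in>free_equiv `` {u}. \<Union>v'\<in>free_equiv `` {v}. free_equiv `` {u @ v})"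
    by (intro SUP_cong refl)
      (simp add: free_equiv_class_eq free_equiv_iff free_equiv_append equivclp_sym)
  also have "\<dots> = free_equiv `` {u @ v}"
  proof -
    have "u \<in> free_equiv `` {u}" "v \<in> free_equiv `` {v}"
      by (simp_all add: free_equiv_iff)
    then have "free_equiv `` {u} \<noteq> {}" "free_equiv `` {v} \<noteq> {}"
      by blast+
    then show ?thesis
      by simp
  qed
  finally show ?thesis
    by (simp add: free_group_def)
qed

lemma free_gen_in_carrier [simp]: "free_gen x \<in> carrier free_group"
  by (simp add: free_gen_def)

abbreviation letter :: "'g \<times> bool \<Rightarrow> 'g word set" where
  "letter l \<equiv> free_equiv `` {[l]}"

lemma letter_cancel: "letter (x, e) \<otimes>\<^bsub>free_group\<^esub> letter (x, \<not> e) = \<one>\<^bsub>free_group\<^esub>"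
  using cancels.intros[of "[]" x e "[]"]
  by (simp add: mult_free_group one_free_group free_equiv_class_eq r_into_equivclp)

lemma group_free_group: "group (free_group :: 'g word set monoid)"
proof (rule groupI)
  fix A :: "'g word set" assume "A \<in> carrier free_group"
  then obtain u where A: "A = free_equiv `` {u}"
    by (rule free_group_cases)
  have "\<exists>v. free_equiv `` {v} \<otimes>\<^bsub>free_group\<^esub> free_equiv `` {u} = \<one>\<^bsub>free_group\<^esub>"
  proof (induction u)
    case Nil
    show ?case
      by (rule exI[of _ "[]"]) (simp add: mult_free_group one_free_group)
  next
    case (Cons l u)
    then obtain v where v: "equivclp cancels (v @ u) []"
      by (auto simp: mult_free_group one_free_group free_equiv_class_eq)
    obtain x e where l: "l = (x, e)"
      by force
    \<comment> \<open>The inverse of a longer word: the inverse letter goes to the right of the inverse of the tail.\<close>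
    have "cancels (v @ [(x, \<not> e), (x, \<not> \<not> e)] @ u) (v @ u)"
      by (rule cancels.intros)
    then have "equivclp cancels ((v @ [(x, \<not> e)]) @ l # u) (v @ u)"
      by (simp add: l r_into_equivclp)
    then have "equivclp cancels ((v @ [(x, \<not> e)]) @ l # u) []"
      using v by (rule equivclp_trans)
    then show ?case
      unfolding mult_free_group one_free_group free_equiv_class_eq by (rule exI)
  qed
  then show "\<exists>B\<in>carrier free_group. B \<otimes>\<^bsub>free_group\<^esub> A = \<one>\<^bsub>free_group\<^esub>"
    by (auto simp: A)
qed (auto simp: mult_free_group one_free_group elim!: free_group_cases)

interpretation free: group "free_group :: 'g word set monoid"
  by (rule group_free_group)

lemma inv_free_gen: "inv\<^bsub>free_group\<^esub> (free_gen x) = letter (x, False)"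
  by (rule free.inv_equality)
    (use letter_cancel[of x False] in \<open>simp_all add: free_gen_def\<close>)

definition word_eval :: "('a, 'm) monoid_scheme \<Rightarrow> ('g \<Rightarrow> 'a) \<Rightarrow> 'g word \<Rightarrow> 'a" where
  "word_eval K f u =
    foldr (\<lambda>(x, e) z. (if e then f x else inv\<^bsub>K\<^esub> f x) \<otimes>\<^bsub>K\<^esub> z) u \<one>\<^bsub>K\<^esub>"

context group
begin

lemma word_eval_closed: "range f \<subseteq> carrier G \<Longrightarrow> word_eval G f u \<in> carrier G"
  by (induction u) (auto simp: word_eval_def image_subset_iff)

lemma word_eval_append:
  assumes "range f \<subseteq> carrier G"
  shows "word_eval G f (u @ v) = word_eval G f u \<otimes> word_eval G f v"
proof (induction u)
  case Nil
  show ?case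
    using word_eval_closed[OF assms, of v] by (simp add: word_eval_def)
next
  case (Cons l u)
  obtain x e where l: "l = (x, e)"
    by force
  have "f x \<in> carrier G"
    using assms by auto
  then show ?case
    using Cons word_eval_closed[OF assms, of u] word_eval_closed[OF assms, of v]
    by (simp add: word_eval_def l m_assoc)
qed

lemma word_eval_cancels:
  assumes "range f \<subseteq> carrier G" and "cancels u v"
  shows "word_eval G f u = word_eval G f v"
  using assms(2)
proof cases
  case (1 w x e z)
  have x: "f x \<in> carrier G"
    using assms(1) by auto
  have "word_eval G f [(x, e), (x, \<not> e)] = \<one>"
    using x by (cases e) (simp_all add: word_eval_def)
  then show ?thesis
    unfolding 1 word_eval_append[OF assms(1)] using word_eval_closed[OF assms(1)] by simp
qed

text \<open>Cancelling two adjacent mutually inverse letters does not change the value of a word in \<open>G\<close>, so the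
  value of a class can be read off from any representative.\<close>

lemma free_group_universal:
  fixes f :: "'g \<Rightarrow> 'a"
  assumes f: "range f \<subseteq> carrier G"
  obtains h where "h \<in> hom free_group G" "\<And>x. h (free_gen x) = f x"
proof
  define h where "h A = word_eval G f (SOME u. u \<in> A)" for A :: "'g word set"
  have h: "h (free_equiv `` {u}) = word_eval G f u" for u
  proof -
    have "(SOME v. v \<in> free_equiv `` {u}) \<in> free_equiv `` {u}"
      by (rule someI[of _ u]) (simp add: free_equiv_iff)
    then have "equivclp cancels u (SOME v. v \<in> free_equiv `` {u})"
      by (simp add: free_equiv_iff)
    then have "word_eval G f u = word_eval G f (SOME v. v \<in> free_equiv `` {u})"
      by (induction rule: equivclp_induct) (use word_eval_cancels[OF f] in auto)
    then show ?thesis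
      by (simp add: h_def)
  qed
  show "h \<in> hom free_group G"
    by (auto simp: hom_def mult_free_group h word_eval_append[OF f] word_eval_closed[OF f]
        elim!: free_group_cases)
  show "h (free_gen x) = f x" for x
    using f by (simp add: free_gen_def h) (simp add: word_eval_def image_subset_iff)
qed

lemma free_group_hom_eqI:
  fixes h h' :: "'g word set \<Rightarrow> 'a"
  assumes h: "h \<in> hom free_group G" and h': "h' \<in> hom free_group G"
    and eq: "\<And>x. h (free_gen x) = h' (free_gen x)" and A: "A \<in> carrier free_group"
  shows "h A = h' A"
proof -
  interpret h: group_hom free_group G h
    by unfold_locales (rule h)
  interpret h': group_hom free_group G h'
    by unfold_locales (rule h')
  obtain u where u: "A = free_equiv `` {u}"
    using A by (rule free_group_cases)
  have letter: "h (letter l) = h' (letter l)" for l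
  proof (cases l)
    case (Pair x e)
    have "h (letter (x, False)) = h' (letter (x, False))"
      unfolding inv_free_gen[symmetric] by (simp add: eq)
    then show ?thesis
      using eq[of x] by (cases e) (simp_all add: Pair free_gen_def)
  qed
  have "h (free_equiv `` {u}) = h' (free_equiv `` {u})"
  proof (induction u)
    case Nil
    show ?case
      using h.hom_one h'.hom_one by (simp add: one_free_group)
  next
    case (Cons l u)
    have c: "letter l \<in> carrier free_group" "free_equiv `` {u} \<in> carrier free_group"
      by simp_all
    show ?case
      using h.hom_mult[OF c] h'.hom_mult[OF c] Cons letter[of l] by (simp add: mult_free_group)
  qed
  then show ?thesis
    by (simp add: u)
qed

lemma normal_closure_normal:
  assumes "S \<subseteq> carrier G"
  shows "normal_closure G S \<lhd> G"
proof -
  have "carrier G \<lhd> G"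
    by (auto simp: normal_inv_iff subgroup_self)
  then have "{N. N \<lhd> G \<and> S \<subseteq> N} \<noteq> {}"
    using assms by auto
  moreover from this have "subgroup (\<Inter>{N. N \<lhd> G \<and> S \<subseteq> N}) G"
    by (intro subgroups_Inter) (auto simp: normal_imp_subgroup)
  ultimately show ?thesis
    unfolding normal_closure_def normal_inv_iff by blast
qed

end

lemma subset_normal_closure: "S \<subseteq> normal_closure G S"
  by (auto simp: normal_closure_def)

lemma normal_closure_least: "N \<lhd> G \<Longrightarrow> S \<subseteq> N \<Longrightarrow> normal_closure G S \<subseteq> N"
  by (auto simp: normal_closure_def)

definition presented_proj :: "'g word set set \<Rightarrow> 'g word set \<Rightarrow> 'g word set set" where
  "presented_proj R A = normal_closure free_group R #>\<^bsub>free_group\<^esub> A"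

lemma group_presented_group:
  "R \<subseteq> carrier free_group \<Longrightarrow> group (presented_group R)"
  unfolding presented_group_def
  by (intro normal.factorgroup_is_group free.normal_closure_normal)

lemma presented_proj_hom:
  "R \<subseteq> carrier free_group \<Longrightarrow> presented_proj R \<in> hom free_group (presented_group R)"
  unfolding presented_group_def presented_proj_def
  by (intro normal.r_coset_hom_Mod free.normal_closure_normal)

lemma carrier_presented_group:
  "carrier (presented_group R) = presented_proj R ` carrier free_group"
  by (simp add: presented_group_def presented_proj_def carrier_FactGroup)

lemma presented_proj_relator:
  assumes R: "R \<subseteq> carrier free_group" and A: "A \<in> R"
  shows "presented_proj R A = \<one>\<^bsub>presented_group R\<^esub>"
proof -
  have "subgroup (normal_closure free_group R) free_group"
    by (intro normal_imp_subgroup free.normal_closure_normal R)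
  moreover have "A \<in> normal_closure free_group R" "A \<in> carrier free_group"
    using R A subset_normal_closure[of R free_group] by auto
  ultimately show ?thesis
    by (simp add: presented_proj_def presented_group_def free.coset_join2)
qed

text \<open>A homomorphism that kills the relators has a normal kernel that contains them, hence contains
  their normal closure, and therefore factors through the quotient.\<close>

lemma (in group) presented_group_universal:
  fixes f :: "'g \<Rightarrow> 'a"
  assumes R: "R \<subseteq> carrier free_group" and h: "h \<in> hom free_group G"
    and rel: "\<And>A. A \<in> R \<Longrightarrow> h A = \<one>"
  obtains g where "g \<in> hom (presented_group R) G"
    "\<And>A. A \<in> carrier free_group \<Longrightarrow> g (presented_proj R A) = h A"
proof -
  interpret h: group_hom free_group G h
    by unfold_locales (rule h)
  have "normal_closure free_group R \<subseteq> kernel free_group G h"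
    using R rel by (intro normal_closure_least h.normal_kernel) (auto simp: kernel_def)
  then show ?thesis
    using h.FactGroup_universal_kernel[OF free.normal_closure_normal[OF R]] that
    unfolding presented_proj_def presented_group_def by blast
qed

text \<open>With this principle, a composite endomorphism is recognised as the identity by looking at the
  generators only.\<close>

lemma (in group) presented_group_hom_eqI:
  fixes h h' :: "'g word set set \<Rightarrow> 'a"
  assumes R: "R \<subseteq> carrier free_group"
    and h: "h \<in> hom (presented_group R) G" and h': "h' \<in> hom (presented_group R) G"
    and eq: "\<And>x. h (presented_proj R (free_gen x)) = h' (presented_proj R (free_gen x))"
    and A: "A \<in> carrier (presented_group R)"
  shows "h A = h' A"
proof -
  obtain B where B: "B \<in> carrier free_group" "A = presented_proj R B"
    using A by (auto simp: carrier_presented_group)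
  show ?thesis
    using free_group_hom_eqI[OF Group.hom_compose[OF presented_proj_hom[OF R] h]
        Group.hom_compose[OF presented_proj_hom[OF R] h'], of B] B eq by simp
qed

section \<open>The plane over the field with \<open>p\<close> elements\<close>

definition plane :: "nat \<Rightarrow> (int \<times> int) monoid" where
  "plane p = integer_mod_group p \<times>\<times> integer_mod_group p"

lemma group_plane: "group (plane p)"
  unfolding plane_def by (intro DirProd_group group_integer_mod_group)

lemma carrier_plane: "p > 0 \<Longrightarrow> carrier (plane p) = {0..<int p} \<times> {0..<int p}"
  by (simp add: plane_def carrier_integer_mod_group)

lemma mult_plane: "(x, y) \<otimes>\<^bsub>plane p\<^esub> (x', y') = ((x + x') mod int p, (y + y') mod int p)"
  by (simp add: plane_def)

lemma one_plane: "\<one>\<^bsub>plane p\<^esub> = (0, 0)"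
  by (simp add: plane_def)

lemma mod_combination:
  fixes m :: int
  shows "((a mod m) * x + (b mod m) * y) mod m = (a * x + b * y) mod m"
    and "(a * (x mod m) + b * (y mod m)) mod m = (a * x + b * y) mod m"
  by (rule mod_add_cong; simp add: mod_mult_left_eq mod_mult_right_eq)+

lemma plane_int_pow:
  assumes "v \<in> carrier (plane p)"
  shows "v [^]\<^bsub>plane p\<^esub> (k :: int) = (k * fst v mod int p, k * snd v mod int p)"
proof (rule prod_eqI)
  have "fst \<in> hom (plane p) (integer_mod_group p)" "snd \<in> hom (plane p) (integer_mod_group p)"
    by (auto simp: hom_def plane_def)
  from this[THEN hom_int_pow, OF assms group_plane group_integer_mod_group, of k]
  show "fst (v [^]\<^bsub>plane p\<^esub> k) = fst (k * fst v mod int p, k * snd v mod int p)"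
    and "snd (v [^]\<^bsub>plane p\<^esub> k) = snd (k * fst v mod int p, k * snd v mod int p)"
    by (simp_all add: int_pow_integer_mod_group)
qed

abbreviation matrices :: "nat \<Rightarrow> int mat monoid" where
  "matrices p \<equiv> matrix_monoid 2 (residue_ring (int p))"

definition mat_act :: "nat \<Rightarrow> int mat \<Rightarrow> int \<times> int \<Rightarrow> int \<times> int" where
  "mat_act p A = (\<lambda>(x, y). ((A $$ (0, 0) * x + A $$ (0, 1) * y) mod int p,
                           (A $$ (1, 0) * x + A $$ (1, 1) * y) mod int p))"

definition gl_action :: "nat \<Rightarrow> int mat \<Rightarrow> int \<times> int \<Rightarrow> int \<times> int" where
  "gl_action p A = restrict (mat_act p A) (carrier (plane p))"

lemma carrier_matrices:
  "A \<in> carrier (matrices p) \<longleftrightarrow>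
    A \<in> carrier_mat 2 2 \<and> (\<forall>i<2. \<forall>j<2. A $$ (i, j) \<in> {0..<int p})"
proof -
  have "elements_mat A \<subseteq> S \<longleftrightarrow> (\<forall>i<2. \<forall>j<2. A $$ (i, j) \<in> S)"
    if A: "A \<in> carrier_mat 2 2" for S
  proof
    assume "elements_mat A \<subseteq> S"
    then show "\<forall>i<2. \<forall>j<2. A $$ (i, j) \<in> S"
      using elements_matI[OF A _ _ refl] by blast
  next
    assume S: "\<forall>i<2. \<forall>j<2. A $$ (i, j) \<in> S"
    show "elements_mat A \<subseteq> S"
    proof
      fix a assume "a \<in> elements_mat A"
      then obtain i j where "i < dim_row A" "j < dim_col A" "a = A $$ (i, j)"
        using elements_matD by blast
      then show "a \<in> S"
        using S A by auto
    qed
  qed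
  moreover have "{0..int p - 1} = {0..<int p}"
    by auto
  ultimately show ?thesis
    by (auto simp: matrix_monoid_def residue_ring_def)
qed

lemma mat_act_closed: "p > 0 \<Longrightarrow> mat_act p A v \<in> carrier (plane p)"
  by (cases v) (simp add: mat_act_def carrier_plane)

lemma mat_act_one: "p > 0 \<Longrightarrow> v \<in> carrier (plane p) \<Longrightarrow> mat_act p \<one>\<^bsub>matrices p\<^esub> v = v"
  by (auto simp: mat_act_def matrix_monoid_def residue_ring_def carrier_plane)

lemma matrices_mult_entry:
  assumes "p > 1" and "i < 2" "j < 2"
  shows "(A \<otimes>\<^bsub>matrices p\<^esub> B) $$ (i, j) =
    (A $$ (i, 0) * B $$ (0, j) + A $$ (i, 1) * B $$ (1, j)) mod int p"
proof -
  interpret R: residues "int p" "residue_ring (int p)"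
    by unfold_locales (use assms in auto)
  show ?thesis
    using assms(2,3) R.sum_cong[of "{..<2}" "\<lambda>k. A $$ (i, k) * B $$ (k, j)"]
    by (simp add: matrix_monoid_def R.res_mult_eq numeral_2_eq_2 lessThan_Suc add.commute)
qed

lemma mat_act_mult:
  assumes "p > 1"
  shows "mat_act p (A \<otimes>\<^bsub>matrices p\<^esub> B) v = mat_act p A (mat_act p B v)"
proof -
  obtain x y where v: "v = (x, y)"
    by force
  show ?thesis
    using assms by (simp add: mat_act_def v matrices_mult_entry mod_combination)
      (simp add: algebra_simps)
qed

lemma mat_act_add:
  "v \<in> carrier (plane p) \<Longrightarrow> w \<in> carrier (plane p) \<Longrightarrow>
    mat_act p A (v \<otimes>\<^bsub>plane p\<^esub> w) = mat_act p A v \<otimes>\<^bsub>plane p\<^esub> mat_act p A w"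
  by (cases v; cases w) (simp add: mat_act_def mult_plane mod_combination mod_add_eq, simp add: algebra_simps)

lemma mat_act_hom: "p > 0 \<Longrightarrow> mat_act p A \<in> hom (plane p) (plane p)"
  by (rule homI) (simp_all add: mat_act_closed mat_act_add)

lemma matrix_eqI:
  assumes "p > 1" and A: "A \<in> carrier (matrices p)" and B: "B \<in> carrier (matrices p)"
    and eq: "\<And>v. v \<in> carrier (plane p) \<Longrightarrow> mat_act p A v = mat_act p B v"
  shows "A = B"
proof (rule eq_matI)
  fix i j :: nat assume "i < dim_row B" "j < dim_col B"
  then have ij: "i < 2" "j < 2"
    using B by (auto simp: carrier_matrices)
  have "(1, 0) \<in> carrier (plane p)" "(0, 1) \<in> carrier (plane p)"
    using assms(1) by (auto simp: carrier_plane)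
  from this[THEN eq] have "A $$ (k, l) mod int p = B $$ (k, l) mod int p" if "k < 2" "l < 2" for k l
    using that by (auto simp: mat_act_def less_2_cases_iff)
  moreover have "A $$ (k, l) mod int p = A $$ (k, l)" "B $$ (k, l) mod int p = B $$ (k, l)"
    if "k < 2" "l < 2" for k l
    using A B that by (simp_all add: carrier_matrices)
  ultimately show "A $$ (i, j) = B $$ (i, j)"
    using ij by simp
qed (use A B in \<open>auto simp: carrier_matrices\<close>)

text \<open>Matrices act faithfully on the plane, so the monoid laws are inherited from composition of maps.\<close>

lemma monoid_matrices:
  assumes "p > 1"
  shows "monoid (matrices p)"
proof
  have closed: "A \<otimes>\<^bsub>matrices p\<^esub> B \<in> carrier (matrices p)" for A B
    using assms by (simp add: carrier_matrices matrices_mult_entry) (simp add: matrix_monoid_def)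
  then show "A \<otimes>\<^bsub>matrices p\<^esub> B \<in> carrier (matrices p)" for A B .
  show one: "\<one>\<^bsub>matrices p\<^esub> \<in> carrier (matrices p)"
    using assms by (simp add: carrier_matrices) (simp add: matrix_monoid_def residue_ring_def)
  fix A B C :: "int mat"
  show "A \<otimes>\<^bsub>matrices p\<^esub> B \<otimes>\<^bsub>matrices p\<^esub> C = A \<otimes>\<^bsub>matrices p\<^esub> (B \<otimes>\<^bsub>matrices p\<^esub> C)"
    by (rule matrix_eqI[OF assms closed closed]) (simp only: mat_act_mult[OF assms])
  assume A: "A \<in> carrier (matrices p)"
  show "\<one>\<^bsub>matrices p\<^esub> \<otimes>\<^bsub>matrices p\<^esub> A = A"
    by (rule matrix_eqI[OF assms closed A])
      (use assms in \<open>simp add: mat_act_mult mat_act_one mat_act_closed\<close>)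
  show "A \<otimes>\<^bsub>matrices p\<^esub> \<one>\<^bsub>matrices p\<^esub> = A"
    by (rule matrix_eqI[OF assms closed A]) (use assms in \<open>simp add: mat_act_mult mat_act_one\<close>)
qed

lemma group_GL: "p > 1 \<Longrightarrow> group (GL 2 p)"
  unfolding GL_def by (intro monoid.units_group monoid_matrices)

text \<open>Modulo any integer, additive maps are linear: \<open>(x, y)\<close> is the sum of \<open>x\<close> copies of \<open>(1, 0)\<close> and
  \<open>y\<close> copies of \<open>(0, 1)\<close>, so a homomorphism is determined by the images of these two vectors, which
  are the columns of its matrix.\<close>

lemma plane_hom_is_matrix:
  assumes "p > 1" and f: "f \<in> hom (plane p) (plane p)"
  obtains A where "A \<in> carrier (matrices p)"
    "\<And>v. v \<in> carrier (plane p) \<Longrightarrow> f v = mat_act p A v"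
proof
  define A where "A = mat 2 2 (\<lambda>(i, j).
    (if i = 0 then fst else snd) (f (if j = 0 then (1, 0) else (0, 1))))"
  have e: "(1, 0) \<in> carrier (plane p)" "(0, 1) \<in> carrier (plane p)"
    using assms(1) by (auto simp: carrier_plane)
  note fe = e[THEN hom_in_carrier[OF f]]
  show "A \<in> carrier (matrices p)"
    using fe assms(1) by (auto simp: A_def carrier_matrices carrier_plane)
  fix v assume v: "v \<in> carrier (plane p)"
  obtain x y where xy: "v = (x, y)"
    by force
  interpret P: group "plane p"
    by (rule group_plane)
  have "v = (1, 0) [^]\<^bsub>plane p\<^esub> x \<otimes>\<^bsub>plane p\<^esub> (0, 1) [^]\<^bsub>plane p\<^esub> y"
    using v assms(1) by (simp add: plane_int_pow e xy carrier_plane mult_plane)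
  then have "f v = f (1, 0) [^]\<^bsub>plane p\<^esub> x \<otimes>\<^bsub>plane p\<^esub> f (0, 1) [^]\<^bsub>plane p\<^esub> y"
    using hom_mult[OF f] P.int_pow_closed e by (simp add: hom_int_pow[OF f _ group_plane group_plane])
  also have "\<dots> = mat_act p A v"
    using fe by (simp add: plane_int_pow mat_act_def A_def xy mult_plane mod_add_eq mult.commute)
  finally show "f v = mat_act p A v" .
qed

lemma carrier_GL: "carrier (GL 2 p) = Units (matrices p)"
  by (simp add: GL_def units_of_carrier)

lemma gl_action_auto:
  assumes "p > 1" and A: "A \<in> carrier (GL 2 p)"
  shows "gl_action p A \<in> auto (plane p)"
proof -
  obtain B where B: "B \<otimes>\<^bsub>matrices p\<^esub> A = \<one>\<^bsub>matrices p\<^esub>" "A \<otimes>\<^bsub>matrices p\<^esub> B = \<one>\<^bsub>matrices p\<^esub>"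
    using A by (auto simp: carrier_GL Units_def)
  have "bij_betw (mat_act p A) (carrier (plane p)) (carrier (plane p))"
    by (rule bij_betw_byWitness[of _ "mat_act p B"])
      (use assms(1) in \<open>simp_all add: mat_act_mult[symmetric] B mat_act_one mat_act_closed image_subset_iff
       \<close>)
  moreover have "restrict (mat_act p A) (carrier (plane p)) \<in> hom (plane p) (plane p)"
    using assms(1) by (intro restrict_hom group_plane mat_act_hom) simp
  ultimately show ?thesis
    by (simp add: auto_iff gl_action_def)
qed

text \<open>For surjectivity, an automorphism and its inverse are both given by matrices; as matrices act
  faithfully, these two are inverse to each other.\<close>

lemma gl_action_iso:
  assumes "p > 1"
  shows "gl_action p \<in> iso (GL 2 p) (AutoGroup (plane p))"
proof (rule isoI)
  show "gl_action p \<in> hom (GL 2 p) (AutoGroup (plane p))"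
  proof (rule homI)
    fix A B assume "A \<in> carrier (GL 2 p)" "B \<in> carrier (GL 2 p)"
    then show "gl_action p (A \<otimes>\<^bsub>GL 2 p\<^esub> B) = gl_action p A \<otimes>\<^bsub>AutoGroup (plane p)\<^esub> gl_action p B"
      using assms
      by (simp add: mult_AutoGroup gl_action_auto)
       (auto simp: gl_action_def compose_def mat_act_mult mat_act_closed GL_def units_of_mult
          intro!: restrict_ext)
  qed (use assms in \<open>simp add: carrier_AutoGroup gl_action_auto\<close>)
  show "bij_betw (gl_action p) (carrier (GL 2 p)) (carrier (AutoGroup (plane p)))"
    unfolding bij_betw_def
  proof
    show "inj_on (gl_action p) (carrier (GL 2 p))"
    proof (rule inj_onI)
      fix A B assume "A \<in> carrier (GL 2 p)" "B \<in> carrier (GL 2 p)"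
        and eq: "gl_action p A = gl_action p B"
      moreover have "mat_act p A v = mat_act p B v" if "v \<in> carrier (plane p)" for v
        using fun_cong[OF eq, of v] that by (simp add: gl_action_def)
      ultimately show "A = B"
        using assms by (intro matrix_eqI) (auto simp: carrier_GL Units_def)
    qed
    have "f \<in> gl_action p ` carrier (GL 2 p)" if f: "f \<in> auto (plane p)" for f
    proof -
      interpret Aut: group "AutoGroup (plane p)"
        by (rule group.AutoGroup[OF group_plane])
      define g where "g = inv\<^bsub>AutoGroup (plane p)\<^esub> f"
      have g: "g \<in> auto (plane p)"
        using f Aut.inv_closed[of f] by (simp add: g_def carrier_AutoGroup)
      have "f \<otimes>\<^bsub>AutoGroup (plane p)\<^esub> g = \<one>\<^bsub>AutoGroup (plane p)\<^esub>"
        "g \<otimes>\<^bsub>AutoGroup (plane p)\<^esub> f = \<one>\<^bsub>AutoGroup (plane p)\<^esub>"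
        using f by (simp_all add: g_def carrier_AutoGroup)
      then have fg: "f (g v) = v" "g (f v) = v" if "v \<in> carrier (plane p)" for v
        using AutoGroup_apply_mult[OF f g that] AutoGroup_apply_mult[OF g f that] that
        by (simp_all add: one_AutoGroup)
      obtain A where A: "A \<in> carrier (matrices p)" "\<And>v. v \<in> carrier (plane p) \<Longrightarrow> f v = mat_act p A v"
        using plane_hom_is_matrix[OF assms auto_hom[OF f]] by blast
      obtain B where B: "B \<in> carrier (matrices p)" "\<And>v. v \<in> carrier (plane p) \<Longrightarrow> g v = mat_act p B v"
        using plane_hom_is_matrix[OF assms auto_hom[OF g]] by blast
      note closed = monoid.m_closed[OF monoid_matrices[OF assms]]
        and one = monoid.one_closed[OF monoid_matrices[OF assms]]
      have act: "mat_act p A v = f v" "mat_act p B v = g v" if "v \<in> carrier (plane p)" for v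
        using A B that by auto
      have "A \<otimes>\<^bsub>matrices p\<^esub> B = \<one>\<^bsub>matrices p\<^esub>"
        by (rule matrix_eqI[OF assms closed[OF A(1) B(1)] one])
          (use assms in \<open>simp add: mat_act_mult mat_act_one act auto_closed[OF g] fg\<close>)
      moreover have "B \<otimes>\<^bsub>matrices p\<^esub> A = \<one>\<^bsub>matrices p\<^esub>"
        by (rule matrix_eqI[OF assms closed[OF B(1) A(1)] one])
          (use assms in \<open>simp add: mat_act_mult mat_act_one act auto_closed[OF f] fg\<close>)
      ultimately have "A \<in> carrier (GL 2 p)"
        using A(1) B(1) unfolding carrier_GL Units_def by blast
      moreover have "f = gl_action p A"
        by (rule auto_eqI[OF f gl_action_auto[OF assms calculation]])
          (simp add: A(2) gl_action_def)
      ultimately show ?thesis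
        by (rule rev_image_eqI)
    qed
    then show "gl_action p ` carrier (GL 2 p) = carrier (AutoGroup (plane p))"
      using gl_action_auto[OF assms] by (auto simp: carrier_AutoGroup)
  qed
qed

lemma comm_group_plane: "comm_group (plane p)"
  by (rule group.group_comm_groupI[OF group_plane]) (auto simp: mult_plane add.commute)

lemma finite_plane: "p > 0 \<Longrightarrow> finite (carrier (plane p))"
  by (simp add: carrier_plane)

section \<open>The extension of the plane by a cyclic group of scalars\<close>

lemma mod_mult_left_cancel:
  fixes a :: int and x y :: int
  assumes "coprime a m" and "(a * x) mod m = (a * y) mod m" and "x \<in> {0..<m}" "y \<in> {0..<m}"
  shows "x = y"
  using assms cong_mult_lcancel[of a m x y] by (auto simp: cong_def)

lemma mat_act_scale:
  "mat_act p A ((t * x) mod int p, (t * y) mod int p) =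
    ((t * fst (mat_act p A (x, y))) mod int p, (t * snd (mat_act p A (x, y))) mod int p)"
  by (simp add: mat_act_def mod_combination mod_mult_right_eq) (simp add: algebra_simps)

text \<open>In the theorem, \<open>n\<close> is \<open>q^2\<close> and \<open>s\<close> is an inverse of \<open>r\<close> modulo \<open>p\<close>, which has the same
  multiplicative order.\<close>

locale scalar_extension =
  fixes p n :: nat and s :: int
  assumes prime_p: "prime p" and n_gt_1: "n > 1" and coprime_pn: "coprime p n"
    and order_s: "\<And>m. [s ^ m = 1] (mod int p) \<longleftrightarrow> n dvd m"
begin

lemma p_gt_1: "p > 1" and p_gt_0: "p > 0"
  using prime_gt_1_nat[OF prime_p] by simp_all

sublocale P: comm_group "plane p"
  by (rule comm_group_plane)

lemma power_mod_n: "[s ^ (m mod n) = s ^ m] (mod int p)"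
proof -
  have "[s ^ (n * (m div n)) * s ^ (m mod n) = 1 * s ^ (m mod n)] (mod int p)"
    by (intro cong_mult cong_refl) (simp add: order_s)
  then show ?thesis
    by (simp add: cong_sym flip: power_add)
qed

lemma power_nat_mod:
  assumes "0 \<le> k" "0 \<le> l"
  shows "s ^ nat ((k + l) mod int n) mod int p = (s ^ nat k * s ^ nat l) mod int p"
proof -
  have "nat ((k + l) mod int n) = (nat k + nat l) mod n"
    using assms by (simp add: nat_mod_distrib nat_add_distrib)
  then show ?thesis
    using power_mod_n[of "nat k + nat l"] by (simp add: cong_def power_add)
qed

lemma coprime_s: "coprime s (int p)"
proof -
  have "[s * s ^ (n - 1) = 1] (mod int p)"
    using order_s[of n] n_gt_1 by (simp flip: power_Suc)
  then show ?thesis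
    by (rule coprime_iff_invertible_int[THEN iffD2, OF exI])
qed

text \<open>As \<open>1 - s\<close> is a unit, every element of the coset of \<open>a\<close> modulo the plane is conjugate to \<open>a\<close> under the
  plane; see \<open>displacement_1_bij\<close>.\<close>

lemma coprime_one_minus_s: "coprime (1 - s) (int p)"
proof -
  have "\<not> [s = 1] (mod int p)"
    using order_s[of 1] n_gt_1 by simp
  then have "\<not> int p dvd 1 - s"
    by (metis cong_iff_dvd_diff cong_sym)
  then show ?thesis
    using prime_imp_coprime[of "int p" "1 - s"] prime_p by (simp add: coprime_commute)
qed

definition scalar :: "int \<Rightarrow> int \<times> int \<Rightarrow> int \<times> int" where
  "scalar k = restrict (\<lambda>(x, y). ((s ^ nat k * x) mod int p, (s ^ nat k * y) mod int p))
    (carrier (plane p))"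

lemma scalar_closed: "v \<in> carrier (plane p) \<Longrightarrow> scalar k v \<in> carrier (plane p)"
  using p_gt_1 by (auto simp: scalar_def carrier_plane)

lemma scalar_mult:
  "v \<in> carrier (plane p) \<Longrightarrow> w \<in> carrier (plane p) \<Longrightarrow>
    scalar k (v \<otimes>\<^bsub>plane p\<^esub> w) = scalar k v \<otimes>\<^bsub>plane p\<^esub> scalar k w"
  using P.m_closed[of v w]
  by (cases v; cases w) (simp add: scalar_def mult_plane mod_simps distrib_left)

lemma scalar_0: "v \<in> carrier (plane p) \<Longrightarrow> scalar 0 v = v"
  using p_gt_1 by (auto simp: scalar_def carrier_plane)

lemma scalar_add:
  assumes "0 \<le> k" "0 \<le> l" and v: "v \<in> carrier (plane p)"
  shows "scalar ((k + l) mod int n) v = scalar k (scalar l v)"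
proof -
  have "(s ^ nat ((k + l) mod int n) * x) mod int p =
      (s ^ nat k * ((s ^ nat l * x) mod int p)) mod int p" for x
    using arg_cong[OF power_nat_mod[OF assms(1,2)], of "\<lambda>t. (t * x) mod int p"]
    by (simp add: mod_simps mult.assoc)
  then show ?thesis
    using v scalar_closed[OF v, of l] by (cases v) (simp add: scalar_def)
qed

lemma scalar_auto:
  assumes k: "k \<in> carrier (integer_mod_group n)"
  shows "scalar k \<in> auto (plane p)"
proof -
  have k: "0 \<le> k" "k < int n"
    using k n_gt_1 by (simp_all add: carrier_integer_mod_group)
  define l where "l = (- k) mod int n"
  have l: "0 \<le> l" "(k + l) mod int n = 0" "(l + k) mod int n = 0"
    using n_gt_1 by (simp_all add: l_def mod_simps)
  have "scalar l (scalar k v) = v" "scalar k (scalar l v) = v" if "v \<in> carrier (plane p)" for v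
    using scalar_add[OF k(1) l(1) that] scalar_add[OF l(1) k(1) that] l
    by (simp_all add: scalar_0[OF that])
  then have "bij_betw (scalar k) (carrier (plane p)) (carrier (plane p))"
    by (intro bij_betw_byWitness[of _ "scalar l"] ballI image_subsetI scalar_closed)
  moreover have "scalar k \<in> hom (plane p) (plane p)"
    by (rule homI) (simp_all add: scalar_closed scalar_mult)
  ultimately show ?thesis
    by (simp add: auto_iff scalar_def)
qed

lemma scalar_hom: "scalar \<in> hom (integer_mod_group n) (AutoGroup (plane p))"
proof (rule homI)
  fix k l assume k: "k \<in> carrier (integer_mod_group n)" and l: "l \<in> carrier (integer_mod_group n)"
  show "scalar (k \<otimes>\<^bsub>integer_mod_group n\<^esub> l) = scalar k \<otimes>\<^bsub>AutoGroup (plane p)\<^esub> scalar l"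
  proof (rule auto_eqI)
    show "scalar (k \<otimes>\<^bsub>integer_mod_group n\<^esub> l) \<in> auto (plane p)"
      using k l by (intro scalar_auto monoid.m_closed[OF group.is_monoid[OF group_integer_mod_group]])
    show "scalar k \<otimes>\<^bsub>AutoGroup (plane p)\<^esub> scalar l \<in> auto (plane p)"
      using monoid.m_closed[OF group.is_monoid[OF P.AutoGroup]] scalar_auto k l
      by (metis carrier_AutoGroup)
  qed (use k l n_gt_1 in \<open>auto simp: AutoGroup_apply_mult scalar_auto scalar_add carrier_integer_mod_group\<close>)
qed (simp add: carrier_AutoGroup scalar_auto)

text \<open>The pair \<open>(v, k)\<close> stands for \<open>v a^k\<close>, where \<open>a v a^-1 = s v\<close>.\<close>

definition extension :: "((int \<times> int) \<times> int) monoid" where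
  "extension = semidirect_product (plane p) (integer_mod_group n) scalar"

lemma group_extension: "group extension"
  unfolding extension_def by (rule group_semidirect_product[OF group_plane group_integer_mod_group scalar_hom])

sublocale E: group extension
  by (rule group_extension)

lemma carrier_extension: "carrier extension = carrier (plane p) \<times> {0..<int n}"
  using n_gt_1 by (simp add: extension_def semidirect_product_simps carrier_integer_mod_group)

lemma mult_extension:
  "(v, k) \<otimes>\<^bsub>extension\<^esub> (w, l) = (v \<otimes>\<^bsub>plane p\<^esub> scalar k w, (k + l) mod int n)"
  by (simp add: extension_def semidirect_product_simps)

lemma one_extension: "\<one>\<^bsub>extension\<^esub> = ((0, 0), 0)"
  by (simp add: extension_def semidirect_product_simps one_plane)

lemma plane_inclusion: "(\<lambda>v. (v, 0)) \<in> hom (plane p) extension"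
  using semidirect_inclusion_left[OF group_plane group_integer_mod_group scalar_hom]
  by (simp add: extension_def)

lemma cyclic_inclusion: "(\<lambda>k. ((0, 0), k)) \<in> hom (integer_mod_group n) extension"
  using semidirect_inclusion_right[OF group_plane group_integer_mod_group scalar_hom]
  by (simp add: extension_def one_plane)

lemma snd_hom: "snd \<in> hom extension (integer_mod_group n)"
  by (simp add: extension_def semidirect_projection)

lemma in_extension: "v \<in> carrier (plane p) \<Longrightarrow> (v, 0) \<in> carrier extension" "((0, 0), 1) \<in> carrier extension"
  using n_gt_1 P.one_closed by (simp_all add: carrier_extension one_plane)

lemma extension_pow: "((0, 0), 1) [^]\<^bsub>extension\<^esub> (k :: int) = ((0, 0), k mod int n)"
  using hom_int_pow[OF cyclic_inclusion _ group_integer_mod_group group_extension, of 1 k] n_gt_1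
  by (simp add: int_pow_integer_mod_group)

lemma extension_decompose:
  assumes "v \<in> carrier (plane p)" and "0 \<le> k" "k < int n"
  shows "(v, k) = (v, 0) \<otimes>\<^bsub>extension\<^esub> ((0, 0), 1) [^]\<^bsub>extension\<^esub> k"
  using assms scalar_0[OF P.one_closed] P.r_one[OF assms(1)]
  by (simp add: extension_pow mult_extension one_plane)

text \<open>The plane and the element \<open>a\<close>, which is \<open>((0, 0), 1)\<close>, generate the extension.\<close>

lemma extension_hom_eqI:
  assumes "group K" and f: "f \<in> hom extension K" and g: "g \<in> hom extension K"
    and plane: "\<And>v. v \<in> carrier (plane p) \<Longrightarrow> f (v, 0) = g (v, 0)"
    and cyclic: "f ((0, 0), 1) = g ((0, 0), 1)" and z: "z \<in> carrier extension"
  shows "f z = g z"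
proof -
  obtain v k where vk: "z = (v, k)" "v \<in> carrier (plane p)" "0 \<le> k" "k < int n"
    using z by (auto simp: carrier_extension)
  show ?thesis
    unfolding vk(1) extension_decompose[OF vk(2-4)]
    using vk(2) plane[OF vk(2)] cyclic
    by (simp add: in_extension hom_mult[OF f] hom_mult[OF g] hom_int_pow[OF f _ group_extension assms(1)]
        hom_int_pow[OF g _ group_extension assms(1)])
qed

section \<open>Automorphisms of the extension\<close>

text \<open>In additive notation, \<open>w a^k w^-1 = (w - s^k w) a^k\<close>: conjugation by an element \<open>w\<close> of the plane
  displaces \<open>a^k\<close> by \<open>(1 - s^k) w\<close>.\<close>

definition displacement :: "int \<Rightarrow> int \<times> int \<Rightarrow> int \<times> int" where
  "displacement k = (\<lambda>(x, y). (((1 - s ^ nat k) * x) mod int p, ((1 - s ^ nat k) * y) mod int p))"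

lemma displacement_closed: "displacement k v \<in> carrier (plane p)"
  using p_gt_1 by (cases v) (simp add: displacement_def carrier_plane)

lemma displacement_0: "displacement 0 v = \<one>\<^bsub>plane p\<^esub>"
  by (cases v) (simp add: displacement_def one_plane)

lemma displacement_mult:
  "displacement k (v \<otimes>\<^bsub>plane p\<^esub> w) = displacement k v \<otimes>\<^bsub>plane p\<^esub> displacement k w"
  by (cases v; cases w) (simp add: displacement_def mult_plane mod_simps distrib_left)

lemma displacement_add:
  assumes "0 \<le> k" "0 \<le> l" 
  shows "displacement ((k + l) mod int n) v = displacement k v \<otimes>\<^bsub>plane p\<^esub> scalar k (displacement l v)"
proof -
  have "((1 - s ^ nat ((k + l) mod int n)) * x) mod int p =
      ((1 - s ^ nat k) * x + s ^ nat k * ((1 - s ^ nat l) * x)) mod int p" for x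
  proof -
    have "[(1 - s ^ nat ((k + l) mod int n)) * x = (1 - s ^ nat k * s ^ nat l) * x] (mod int p)"
      using power_nat_mod[OF assms] by (intro cong_mult cong_diff cong_refl) (simp add: cong_def)
    then show ?thesis
      by (simp add: cong_def algebra_simps)
  qed
  then show ?thesis
    using displacement_closed[of l v] by (cases v) (simp add: displacement_def scalar_def mult_plane mod_simps)
qed

lemma mat_act_scalar:
  "v \<in> carrier (plane p) \<Longrightarrow> mat_act p A (scalar k v) = scalar k (mat_act p A v)"
  using mat_act_closed[OF p_gt_0, of A v] by (cases v) (simp add: scalar_def mat_act_scale split_beta)

lemma mat_act_displacement: "mat_act p A (displacement k v) = displacement k (mat_act p A v)"
  by (cases v) (simp only: displacement_def split_beta fst_conv snd_conv mat_act_scale)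

lemma displacement_1_bij: "bij_betw (displacement 1) (carrier (plane p)) (carrier (plane p))"
proof -
  have "inj_on (displacement 1) (carrier (plane p))"
  proof (rule inj_onI)
    fix v w assume vw: "v \<in> carrier (plane p)" "w \<in> carrier (plane p)"
      and eq: "displacement 1 v = displacement 1 w"
    have "fst v = fst w" "snd v = snd w"
      by (rule mod_mult_left_cancel[OF coprime_one_minus_s],
          use vw eq p_gt_0 in \<open>simp_all add: displacement_def carrier_plane split_beta mem_Times_iff\<close>)+
    then show "v = w"
      by (rule prod_eqI)
  qed
  moreover from this have "displacement 1 ` carrier (plane p) = carrier (plane p)"
    by (intro endo_inj_surj finite_plane p_gt_0 image_subsetI displacement_closed)
  ultimately show ?thesis
    by (simp add: bij_betw_def)
qed

text \<open>The linear map \<open>A\<close>, extended by \<open>a \<mapsto> a\<close>, followed by conjugation by \<open>w\<close>. Parametrising by the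
  conjugating element \<open>w\<close> rather than by the image \<open>u a\<close> of \<open>a\<close> gives the image of \<open>a^k\<close> in closed form
  and avoids the geometric sum \<open>u + s u + ... + s^(k - 1) u\<close>.\<close>

definition affine :: "int \<times> int \<Rightarrow> int mat \<Rightarrow> (int \<times> int) \<times> int \<Rightarrow> (int \<times> int) \<times> int" where
  "affine w A = restrict (\<lambda>(v, k). (mat_act p A v \<otimes>\<^bsub>plane p\<^esub> displacement k w, k)) (carrier extension)"

lemma affine_hom:
  assumes w: "w \<in> carrier (plane p)"
  shows "affine w A \<in> hom extension extension"
  unfolding affine_def
proof (intro restrict_hom group_extension homI)
  note closed = displacement_closed scalar_closed mat_act_closed[OF p_gt_0]
  fix z z' assume z: "z \<in> carrier extension" and z': "z' \<in> carrier extension"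
  show "(case z of (v, k) \<Rightarrow> (mat_act p A v \<otimes>\<^bsub>plane p\<^esub> displacement k w, k)) \<in> carrier extension"
    using z by (auto simp: carrier_extension closed)
  obtain v k v' k' where vk: "z = (v, k)" "z' = (v', k')"
    by (cases z, cases z')
  have c: "v \<in> carrier (plane p)" "v' \<in> carrier (plane p)" "0 \<le> k" "0 \<le> k'"
    using z z' by (auto simp: vk carrier_extension)
  show "(case z \<otimes>\<^bsub>extension\<^esub> z' of (v, k) \<Rightarrow> (mat_act p A v \<otimes>\<^bsub>plane p\<^esub> displacement k w, k)) =
      (case z of (v, k) \<Rightarrow> (mat_act p A v \<otimes>\<^bsub>plane p\<^esub> displacement k w, k)) \<otimes>\<^bsub>extension\<^esub>
      (case z' of (v, k) \<Rightarrow> (mat_act p A v \<otimes>\<^bsub>plane p\<^esub> displacement k w, k))"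
    using c w by (simp add: vk mult_extension mat_act_add mat_act_scalar displacement_add scalar_mult closed P.m_ac)
qed

lemma affine_apply:
  "v \<in> carrier (plane p) \<Longrightarrow> 0 \<le> k \<Longrightarrow> k < int n \<Longrightarrow>
    affine w A (v, k) = (mat_act p A v \<otimes>\<^bsub>plane p\<^esub> displacement k w, k)"
  by (simp add: affine_def carrier_extension)

lemma affine_auto:
  assumes w: "w \<in> carrier (plane p)" and A: "A \<in> carrier (GL 2 p)"
  shows "affine w A \<in> auto extension"
proof -
  have inj: "inj_on (mat_act p A) (carrier (plane p))"
    using auto_inj[OF gl_action_auto[OF p_gt_1 A]] by (simp add: gl_action_def inj_on_def)
  have "inj_on (affine w A) (carrier extension)"
  proof (rule inj_onI)
    fix z z' assume z: "z \<in> carrier extension" "z' \<in> carrier extension" and eq: "affine w A z = affine w A z'"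
    obtain v k v' k' where vk: "z = (v, k)" "z' = (v', k')"
      by (cases z, cases z')
    have c: "v \<in> carrier (plane p)" "v' \<in> carrier (plane p)" "0 \<le> k" "k < int n" "0 \<le> k'" "k' < int n"
      using z by (auto simp: vk carrier_extension)
    have "k = k'" "mat_act p A v \<otimes>\<^bsub>plane p\<^esub> displacement k w = mat_act p A v' \<otimes>\<^bsub>plane p\<^esub> displacement k w"
      using eq c by (auto simp: vk affine_apply)
    then show "z = z'"
      using inj c p_gt_1 by (simp add: vk displacement_closed mat_act_closed inj_on_eq_iff)
  qed
  moreover from this have "affine w A ` carrier extension = carrier extension"
    using hom_carrier[OF affine_hom[OF w]] p_gt_0
    by (intro endo_inj_surj) (simp_all add: carrier_extension finite_plane)
  ultimately show ?thesis
    by (simp add: auto_iff bij_betw_def affine_hom w) (simp add: affine_def)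
qed

lemma affine_compose:
  assumes "w \<in> carrier (plane p)" "w' \<in> carrier (plane p)" and z: "z \<in> carrier extension"
  shows "affine (w \<otimes>\<^bsub>plane p\<^esub> mat_act p A w') (A \<otimes>\<^bsub>matrices p\<^esub> A') z = affine w A (affine w' A' z)"
proof -
  note closed = displacement_closed mat_act_closed[OF p_gt_0]
  obtain v k where vk: "z = (v, k)" "v \<in> carrier (plane p)" "0 \<le> k" "k < int n"
    using z by (auto simp: carrier_extension)
  have "affine w A (affine w' A' z) =
      (mat_act p A (mat_act p A' v) \<otimes>\<^bsub>plane p\<^esub> displacement k (mat_act p A w') \<otimes>\<^bsub>plane p\<^esub> displacement k w, k)"
    using vk by (simp add: affine_apply closed mat_act_add mat_act_displacement)
  also have "\<dots> = affine (w \<otimes>\<^bsub>plane p\<^esub> mat_act p A w') (A \<otimes>\<^bsub>matrices p\<^esub> A') z"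
    using vk P.m_comm[OF displacement_closed displacement_closed, of k w k "mat_act p A w'"]
    by (simp add: affine_apply mat_act_mult[OF p_gt_1] displacement_mult P.m_assoc closed)
  finally show ?thesis ..
qed

text \<open>Surjectivity is the heart of the matter. Let \<open>\<alpha>\<close> be an automorphism. Elements of the plane have
  order dividing \<open>p\<close>, and \<open>p\<close> is prime to \<open>n\<close>, so \<open>\<alpha>\<close> maps the plane to itself, by a matrix \<open>A\<close>. Write
  \<open>\<alpha>(a) = u a^l\<close>. Applying \<open>\<alpha>\<close> to \<open>a v = (s v) a\<close> and using that \<open>A\<close> commutes with scalars gives
  \<open>s^l = s\<close> modulo \<open>p\<close>, so \<open>l = 1\<close>. Finally \<open>u = (1 - s) w\<close> for some \<open>w\<close>, and \<open>\<alpha>\<close> agrees with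
  \<open>affine w A\<close> on the plane and at \<open>a\<close>.\<close>

lemma affine_iso:
  "(\<lambda>(w, A). affine w A) \<in>
    iso (semidirect_product (plane p) (GL 2 p) (gl_action p)) (AutoGroup extension)"
proof (rule isoI)
  note closed = mat_act_closed[OF p_gt_0]
  have action: "gl_action p A w = mat_act p A w" if "w \<in> carrier (plane p)" for w A
    using that by (simp add: gl_action_def)
  let ?\<Phi> = "\<lambda>(w, A). affine w A"
  let ?S = "semidirect_product (plane p) (GL 2 p) (gl_action p)"
  show hom: "?\<Phi> \<in> hom ?S (AutoGroup extension)"
  proof (rule homI)
    fix z z' assume "z \<in> carrier ?S" "z' \<in> carrier ?S"
    then obtain w A w' A' where z: "z = (w, A)" "z' = (w', A')"
      and c: "w \<in> carrier (plane p)" "A \<in> carrier (GL 2 p)"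
        "w' \<in> carrier (plane p)" "A' \<in> carrier (GL 2 p)"
      by (auto simp: semidirect_product_simps)
    have "affine (w \<otimes>\<^bsub>plane p\<^esub> mat_act p A w') (A \<otimes>\<^bsub>matrices p\<^esub> A') =
        affine w A \<otimes>\<^bsub>AutoGroup extension\<^esub> affine w' A'"
    proof
      fix x show "affine (w \<otimes>\<^bsub>plane p\<^esub> mat_act p A w') (A \<otimes>\<^bsub>matrices p\<^esub> A') x =
        (affine w A \<otimes>\<^bsub>AutoGroup extension\<^esub> affine w' A') x"
        using c affine_compose[OF c(1,3), of x]
        by (cases "x \<in> carrier extension")
          (simp_all add: mult_AutoGroup affine_auto compose_def, simp add: affine_def)
    qed
    then show "?\<Phi> (z \<otimes>\<^bsub>?S\<^esub> z') = ?\<Phi> z \<otimes>\<^bsub>AutoGroup extension\<^esub> ?\<Phi> z'"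
      using c by (simp add: z semidirect_product_simps action GL_def units_of_mult)
  qed (auto simp: semidirect_product_simps carrier_AutoGroup affine_auto)
  have "inj_on ?\<Phi> (carrier ?S)"
  proof (rule inj_onI)
    fix z z' assume "z \<in> carrier ?S" "z' \<in> carrier ?S" and eq: "?\<Phi> z = ?\<Phi> z'"
    then obtain w A w' A' where z: "z = (w, A)" "z' = (w', A')"
      and c: "w \<in> carrier (plane p)" "A \<in> carrier (GL 2 p)"
        "w' \<in> carrier (plane p)" "A' \<in> carrier (GL 2 p)"
      by (auto simp: semidirect_product_simps)
    have eq: "affine w A x = affine w' A' x" for x
      using eq by (simp add: z)
    have act: "mat_act p A v = mat_act p A' v" if v: "v \<in> carrier (plane p)" for v
      using eq[of "(v, 0)"] v n_gt_1 by (simp add: affine_apply displacement_0 closed)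
    have "A = A'"
      using c act by (intro matrix_eqI[OF p_gt_1]) (auto simp: carrier_GL Units_def)
    moreover have "displacement 1 w = displacement 1 w'"
      using eq[of "(\<one>\<^bsub>plane p\<^esub>, 1)"] n_gt_1 act[OF P.one_closed] closed[of A' "\<one>\<^bsub>plane p\<^esub>"]
      by (simp add: affine_apply displacement_closed)
    then have "w = w'"
      using inj_onD[OF bij_betw_imp_inj_on[OF displacement_1_bij]] c(1,3) by blast
    ultimately show "z = z'"
      by (simp add: z)
  qed
  moreover have "\<alpha> \<in> ?\<Phi> ` carrier ?S" if \<alpha>: "\<alpha> \<in> auto extension" for \<alpha>
  proof -
    note \<alpha>_hom = auto_hom[OF \<alpha>]
    define f where "f v = fst (\<alpha> (v, 0))" for v
    have \<alpha>_plane: "\<alpha> (v, 0) = (f v, 0)" "f v \<in> carrier (plane p)" if v: "v \<in> carrier (plane p)" for v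
    proof -
      have h: "(\<lambda>v. snd (\<alpha> (v, 0))) \<in> hom (plane p) (integer_mod_group n)"
        using Group.hom_compose[OF Group.hom_compose[OF plane_inclusion \<alpha>_hom] snd_hom]
        by (simp add: comp_def)
      have in_extension: "\<alpha> (v, 0) \<in> carrier extension"
        using auto_closed[OF \<alpha>] v in_extension by simp
      \<comment> \<open>The cyclic component of the image is killed by \<open>p\<close> in a group of order \<open>n\<close>.\<close>
      have "v [^]\<^bsub>plane p\<^esub> int p = \<one>\<^bsub>plane p\<^esub>"
        using v by (simp add: plane_int_pow one_plane)
      then have "(int p * snd (\<alpha> (v, 0))) mod int n = 0"
        using hom_int_pow[OF h v group_plane group_integer_mod_group, of "int p"]
          hom_one[OF h group_plane group_integer_mod_group]
        by (simp add: int_pow_integer_mod_group)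
      then have "int n dvd snd (\<alpha> (v, 0))"
        using coprime_pn by (simp add: coprime_commute coprime_dvd_mult_right_iff dvd_eq_mod_eq_0[symmetric])
      then have "snd (\<alpha> (v, 0)) = 0"
        using in_extension zdvd_not_zless[of "snd (\<alpha> (v, 0))" "int n"] by (force simp: carrier_extension)
      then show "\<alpha> (v, 0) = (f v, 0)"
        by (simp add: f_def prod_eq_iff)
      show "f v \<in> carrier (plane p)"
        using in_extension by (auto simp: f_def carrier_extension)
    qed
    have f_hom: "f \<in> hom (plane p) (plane p)"
    proof (rule homI)
      fix v w assume vw: "v \<in> carrier (plane p)" "w \<in> carrier (plane p)"
      then have "\<alpha> (v \<otimes>\<^bsub>plane p\<^esub> w, 0) = \<alpha> (v, 0) \<otimes>\<^bsub>extension\<^esub> \<alpha> (w, 0)"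
        using hom_mult[OF Group.hom_compose[OF plane_inclusion \<alpha>_hom] vw] by simp
      then show "f (v \<otimes>\<^bsub>plane p\<^esub> w) = f v \<otimes>\<^bsub>plane p\<^esub> f w"
        using vw by (simp add: \<alpha>_plane mult_extension scalar_0)
    qed (rule \<alpha>_plane(2))
    have "inj_on f (carrier (plane p))"
    proof (rule inj_onI)
      fix v w assume "v \<in> carrier (plane p)" "w \<in> carrier (plane p)" "f v = f w"
      then show "v = w"
        using inj_onD[OF auto_inj[OF \<alpha>], of "(v, 0)" "(w, 0)"] by (simp add: \<alpha>_plane in_extension)
    qed
    moreover from this have f_surj: "f ` carrier (plane p) = carrier (plane p)"
      using \<alpha>_plane(2) by (intro endo_inj_surj finite_plane p_gt_0) auto
    ultimately have "bij_betw (restrict f (carrier (plane p))) (carrier (plane p)) (carrier (plane p))"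
      by (simp add: bij_betw_def)
    then have "restrict f (carrier (plane p)) \<in> auto (plane p)"
      using f_hom by (simp add: auto_iff restrict_hom group_plane)
    then have "restrict f (carrier (plane p)) \<in> gl_action p ` carrier (GL 2 p)"
      using gl_action_iso[OF p_gt_1] by (simp add: iso_iff carrier_AutoGroup)
    then obtain A where A: "A \<in> carrier (GL 2 p)" "restrict f (carrier (plane p)) = gl_action p A"
      by (auto simp only: image_iff)
    have f: "f v = mat_act p A v" if "v \<in> carrier (plane p)" for v
      using fun_cong[OF A(2), of v] that by (simp add: gl_action_def)
    obtain u l where ul: "\<alpha> ((0, 0), 1) = (u, l)"
      by (cases "\<alpha> ((0, 0), 1)")
    then have u: "u \<in> carrier (plane p)" and l: "0 \<le> l" "l < int n"
      using auto_closed[OF \<alpha> in_extension(2)] by (auto simp: carrier_extension)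
    have "l = 1"
    proof -
      have e: "(1, 0) \<in> carrier (plane p)"
        using p_gt_1 by (simp add: carrier_plane)
      then have "(1, 0) \<in> f ` carrier (plane p)"
        by (simp only: f_surj)
      then obtain v where "(1, 0) = f v" "v \<in> carrier (plane p)"
        by (rule imageE)
      then have v: "v \<in> carrier (plane p)" "f v = (1, 0)"
        by simp_all
      have sv: "scalar 1 v \<in> carrier (plane p)"
        using v by (simp add: scalar_closed)
      have "((0, 0), 1) \<otimes>\<^bsub>extension\<^esub> (v, 0) = (scalar 1 v, 0) \<otimes>\<^bsub>extension\<^esub> ((0, 0), 1)"
        using P.l_one[OF sv] P.r_one[OF sv] scalar_0[OF P.one_closed] by (simp add: mult_extension one_plane)
      then have "\<alpha> ((0, 0), 1) \<otimes>\<^bsub>extension\<^esub> \<alpha> (v, 0) = \<alpha> (scalar 1 v, 0) \<otimes>\<^bsub>extension\<^esub> \<alpha> ((0, 0), 1)"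
        using v sv in_extension by (simp flip: hom_mult[OF \<alpha>_hom])
      then have "u \<otimes>\<^bsub>plane p\<^esub> scalar l (1, 0) = f (scalar 1 v) \<otimes>\<^bsub>plane p\<^esub> u"
        using v sv u by (simp add: ul \<alpha>_plane mult_extension scalar_0)
      also have "f (scalar 1 v) = scalar 1 (1, 0)"
        using v sv f[OF v(1)] by (simp add: f mat_act_scalar)
      finally have "scalar l (1, 0) = scalar 1 (1, 0)"
        using u e by (simp add: P.m_comm[of _ u] scalar_closed)
      then have *: "[s ^ nat l = s] (mod int p)"
        using e by (simp add: scalar_def cong_def)
      have "nat l \<noteq> 0"
        using * order_s[of 1] n_gt_1 by (auto simp: cong_sym_eq)
      then have "s ^ nat l = s * s ^ (nat l - 1)"
        by (metis One_nat_def Suc_pred neq0_conv power_Suc)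
      then have "[s * s ^ (nat l - 1) = s * 1] (mod int p)"
        using * by simp
      then have "[s ^ (nat l - 1) = 1] (mod int p)"
        by (rule cong_mult_lcancel[OF coprime_s, THEN iffD1])
      then have "n dvd nat l - 1"
        by (rule order_s[THEN iffD1])
      then have "nat l - 1 = 0"
        using l nat_dvd_not_less[of "nat l - 1" n] by linarith
      then show "l = 1"
        using \<open>nat l \<noteq> 0\<close> by simp
    qed
    obtain w where w: "w \<in> carrier (plane p)" "displacement 1 w = u"
      using displacement_1_bij u by (metis bij_betw_def imageE)
    have "\<alpha> = affine w A"
    proof (rule auto_eqI[OF \<alpha> affine_auto[OF w(1) A(1)]])
      fix x assume x: "x \<in> carrier extension"
      show "\<alpha> x = affine w A x"
      proof (rule extension_hom_eqI[OF group_extension \<alpha>_hom affine_hom[OF w(1)] _ _ x])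
        fix v assume v: "v \<in> carrier (plane p)"
        have "affine w A (v, 0) = (mat_act p A v, 0)"
          using affine_apply[OF v, of 0 w A] n_gt_1 P.r_one[OF closed, of A v]
          by (simp add: displacement_0)
        then show "\<alpha> (v, 0) = affine w A (v, 0)"
          using \<alpha>_plane(1)[OF v] f[OF v] by simp
      next
        have "affine w A ((0, 0), 1) = (u, 1)"
          using affine_apply[OF P.one_closed, of 1 w A] n_gt_1 w(2) P.l_one[OF u]
            hom_one[OF mat_act_hom[OF p_gt_0] group_plane group_plane, of A]
          by (simp add: one_plane)
        then show "\<alpha> ((0, 0), 1) = affine w A ((0, 0), 1)"
          using ul \<open>l = 1\<close> by simp
      qed
    qed
    then have "\<alpha> = ?\<Phi> (w, A)"
      by simp
    moreover have "(w, A) \<in> carrier ?S"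
      using w(1) A(1) by (simp add: semidirect_product_simps)
    ultimately show ?thesis
      by (rule image_eqI)
  qed
  then have "auto extension \<subseteq> ?\<Phi> ` carrier ?S"
    by (rule subsetI)
  then have "?\<Phi> ` carrier ?S = carrier (AutoGroup extension)"
    using hom_carrier[OF hom] by (simp only: carrier_AutoGroup subset_antisym)
  ultimately show "bij_betw ?\<Phi> (carrier ?S) (carrier (AutoGroup extension))"
    by (simp add: bij_betw_def)
qed

end

section \<open>The presented group is the extension\<close>

context group
begin

lemma mult_inv_eq_one_iff:
  "x \<in> carrier G \<Longrightarrow> y \<in> carrier G \<Longrightarrow> x \<otimes> inv y = \<one> \<longleftrightarrow> x = y"
  by (metis inv_equality inv_inv inv_closed r_inv)

lemma inv_mult_eq_iff:
  "x \<in> carrier G \<Longrightarrow> y \<in> carrier G \<Longrightarrow> z \<in> carrier G \<Longrightarrow> inv x \<otimes> y = z \<longleftrightarrow> y = x \<otimes> z"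
  using inv_solve_left[of z x y] by auto

lemma conjugation_relation_iff:
  assumes "x \<in> carrier G" "y \<in> carrier G" "z \<in> carrier G"
  shows "(inv x \<otimes> y \<otimes> x) \<otimes> inv z = \<one> \<longleftrightarrow> y \<otimes> x = x \<otimes> z"
proof -
  have "(inv x \<otimes> y \<otimes> x) \<otimes> inv z = \<one> \<longleftrightarrow> inv x \<otimes> y \<otimes> x = z"
    using assms by (intro mult_inv_eq_one_iff) simp_all
  also have "\<dots> \<longleftrightarrow> y \<otimes> x = x \<otimes> z"
    using assms by (simp add: m_assoc inv_mult_eq_iff)
  finally show ?thesis .
qed

lemma commutator_eq_one_iff:
  assumes "x \<in> carrier G" "y \<in> carrier G"
  shows "commutator G x y = \<one> \<longleftrightarrow> x \<otimes> y = y \<otimes> x"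
  using assms by (simp add: commutator_def m_assoc inv_mult_eq_iff)

text \<open>The relation says that conjugation by \<open>y\<close> maps \<open>x\<close> to \<open>z\<close>; being a homomorphism, it maps powers to
  powers.\<close>

lemma int_pow_transport:
  assumes x: "x \<in> carrier G" and y: "y \<in> carrier G" and z: "z \<in> carrier G"
    and rel: "x \<otimes> y = y \<otimes> z"
  shows "x [^] (i :: int) \<otimes> y = y \<otimes> z [^] i"
proof -
  have "y \<otimes> (inv y \<otimes> u) = u" if "u \<in> carrier G" for u
    using y that by (simp flip: m_assoc)
  then have "(\<lambda>u. inv y \<otimes> u \<otimes> y) \<in> hom G G"
    using y by (auto simp: hom_def m_assoc)
  from hom_int_pow[OF this x is_group is_group, of i]
  have "inv y \<otimes> x [^] i \<otimes> y = z [^] i"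
    using assms by (simp add: m_assoc inv_mult_eq_iff[THEN iffD2])
  then show ?thesis
    using assms by (simp add: m_assoc inv_mult_eq_iff)
qed

lemma int_pow_commute:
  assumes "x \<in> carrier G" "y \<in> carrier G" "x \<otimes> y = y \<otimes> x"
  shows "x [^] (i :: int) \<otimes> y [^] (j :: int) = y [^] j \<otimes> x [^] i"
proof -
  have "x [^] i \<otimes> y = y \<otimes> x [^] i"
    using assms by (intro int_pow_transport)
  then show ?thesis
    using assms int_pow_transport[of y "x [^] i" y j] by simp
qed

lemma int_pow_cong:
  assumes x: "x \<in> carrier G" and m: "x [^] (m :: nat) = \<one>" and ij: "[i = j] (mod int m)"
  shows "x [^] i = x [^] j"
proof -
  obtain d where "i = j + int m * d"
    using ij by (metis cong_iff_lin cong_sym)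
  then show ?thesis
    using x m by (simp add: int_pow_mult int_pow_int flip: int_pow_pow)
qed

end

definition relators :: "nat \<Rightarrow> nat \<Rightarrow> int \<Rightarrow> generator word set set" where
  "relators n p r =
    (let F = free_group; a = free_gen Gen_a; b = free_gen Gen_b; c = free_gen Gen_c
     in {a [^]\<^bsub>F\<^esub> n, b [^]\<^bsub>F\<^esub> p, c [^]\<^bsub>F\<^esub> p, commutator F b c,
         (inv\<^bsub>F\<^esub> a \<otimes>\<^bsub>F\<^esub> b \<otimes>\<^bsub>F\<^esub> a) \<otimes>\<^bsub>F\<^esub> inv\<^bsub>F\<^esub> (b [^]\<^bsub>F\<^esub> r),
         (inv\<^bsub>F\<^esub> a \<otimes>\<^bsub>F\<^esub> c \<otimes>\<^bsub>F\<^esub> a) \<otimes>\<^bsub>F\<^esub> inv\<^bsub>F\<^esub> (c [^]\<^bsub>F\<^esub> r)})"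

lemma the_group_eq: "the_group p q r = presented_group (relators (q\<^sup>2) p r)"
  by (simp add: the_group_def relators_def Let_def)

lemma relators_in_free_group: "relators n p r \<subseteq> carrier free_group"
  by (simp add: relators_def Let_def commutator_def)

definition satisfies_relations ::
    "('a, 'm) monoid_scheme \<Rightarrow> nat \<Rightarrow> nat \<Rightarrow> int \<Rightarrow> 'a \<Rightarrow> 'a \<Rightarrow> 'a \<Rightarrow> bool" where
  "satisfies_relations K n p r a b c \<longleftrightarrow>
    a [^]\<^bsub>K\<^esub> n = \<one>\<^bsub>K\<^esub> \<and> b [^]\<^bsub>K\<^esub> p = \<one>\<^bsub>K\<^esub> \<and> c [^]\<^bsub>K\<^esub> p = \<one>\<^bsub>K\<^esub> \<and> b \<otimes>\<^bsub>K\<^esub> c = c \<otimes>\<^bsub>K\<^esub> b \<and>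
    b \<otimes>\<^bsub>K\<^esub> a = a \<otimes>\<^bsub>K\<^esub> b [^]\<^bsub>K\<^esub> r \<and> c \<otimes>\<^bsub>K\<^esub> a = a \<otimes>\<^bsub>K\<^esub> c [^]\<^bsub>K\<^esub> r"

lemma (in group) relators_trivial_iff:
  assumes h: "h \<in> hom free_group G"
  shows "(\<forall>A\<in>relators n p r. h A = \<one>) \<longleftrightarrow>
    satisfies_relations G n p r (h (free_gen Gen_a)) (h (free_gen Gen_b)) (h (free_gen Gen_c))"
proof -
  interpret h: group_hom free_group G h
    by unfold_locales (rule h)
  have "h (commutator free_group x y) = commutator G (h x) (h y)"
    if "x \<in> carrier free_group" "y \<in> carrier free_group" for x y
    using that by (simp add: commutator_def)
  then show ?thesis
    by (simp add: relators_def Let_def satisfies_relations_def h.hom_nat_pow h.hom_int_pow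
        commutator_eq_one_iff conjugation_relation_iff)
qed

context scalar_extension
begin

definition normal_form ::
    "('a, 'm) monoid_scheme \<Rightarrow> 'a \<Rightarrow> 'a \<Rightarrow> 'a \<Rightarrow> (int \<times> int) \<times> int \<Rightarrow> 'a" where
  "normal_form K a b c = (\<lambda>((x, y), k). b [^]\<^bsub>K\<^esub> x \<otimes>\<^bsub>K\<^esub> c [^]\<^bsub>K\<^esub> y \<otimes>\<^bsub>K\<^esub> a [^]\<^bsub>K\<^esub> k)"

text \<open>The relation \<open>a^-1 d a = d^r\<close>, for \<open>d = b\<close> and \<open>d = c\<close>, turns into \<open>a d = d^s a\<close>, since \<open>s\<close> is inverse to
  \<open>r\<close> modulo \<open>p\<close>. Moving powers of \<open>a\<close> to the right by this rule multiplies two normal forms exactly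
  as the extension does.\<close>

lemma normal_form_hom:
  assumes "group K" and a: "a \<in> carrier K" and b: "b \<in> carrier K" and c: "c \<in> carrier K"
    and rel: "satisfies_relations K n p r a b c" and rs: "[r * s = 1] (mod int p)"
  shows "normal_form K a b c \<in> hom extension K"
proof -
  interpret K: group K by fact
  have rel: "a [^]\<^bsub>K\<^esub> n = \<one>\<^bsub>K\<^esub>" "b [^]\<^bsub>K\<^esub> p = \<one>\<^bsub>K\<^esub>" "c [^]\<^bsub>K\<^esub> p = \<one>\<^bsub>K\<^esub>" "b \<otimes>\<^bsub>K\<^esub> c = c \<otimes>\<^bsub>K\<^esub> b"
    "b \<otimes>\<^bsub>K\<^esub> a = a \<otimes>\<^bsub>K\<^esub> b [^]\<^bsub>K\<^esub> r" "c \<otimes>\<^bsub>K\<^esub> a = a \<otimes>\<^bsub>K\<^esub> c [^]\<^bsub>K\<^esub> r"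
    using rel by (simp_all add: satisfies_relations_def)
  have move: "a [^]\<^bsub>K\<^esub> k \<otimes>\<^bsub>K\<^esub> d [^]\<^bsub>K\<^esub> (x :: int) = d [^]\<^bsub>K\<^esub> (s ^ k * x) \<otimes>\<^bsub>K\<^esub> a [^]\<^bsub>K\<^esub> k"
    if d: "d \<in> carrier K" "d [^]\<^bsub>K\<^esub> p = \<one>\<^bsub>K\<^esub>" "d \<otimes>\<^bsub>K\<^esub> a = a \<otimes>\<^bsub>K\<^esub> d [^]\<^bsub>K\<^esub> r" for d x and k :: nat
  proof (induction k arbitrary: x)
    case (Suc k)
    have "d [^]\<^bsub>K\<^esub> (s * x) \<otimes>\<^bsub>K\<^esub> a = a \<otimes>\<^bsub>K\<^esub> d [^]\<^bsub>K\<^esub> (r * (s * x))"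
      using a d K.int_pow_transport[of d a "d [^]\<^bsub>K\<^esub> r" "s * x"] by (simp add: K.int_pow_pow)
    also have "d [^]\<^bsub>K\<^esub> (r * (s * x)) = d [^]\<^bsub>K\<^esub> x"
      using d cong_mult[OF rs cong_refl[of x]] by (intro K.int_pow_cong) (simp_all add: mult.assoc)
    finally have step: "a \<otimes>\<^bsub>K\<^esub> d [^]\<^bsub>K\<^esub> x = d [^]\<^bsub>K\<^esub> (s * x) \<otimes>\<^bsub>K\<^esub> a" ..
    have "a [^]\<^bsub>K\<^esub> Suc k \<otimes>\<^bsub>K\<^esub> d [^]\<^bsub>K\<^esub> x = a [^]\<^bsub>K\<^esub> k \<otimes>\<^bsub>K\<^esub> d [^]\<^bsub>K\<^esub> (s * x) \<otimes>\<^bsub>K\<^esub> a"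
      using a d by (simp add: K.m_assoc step)
    also have "\<dots> = d [^]\<^bsub>K\<^esub> (s ^ Suc k * x) \<otimes>\<^bsub>K\<^esub> a [^]\<^bsub>K\<^esub> Suc k"
      using a d by (simp add: Suc K.m_assoc mult.assoc mult.left_commute)
    finally show ?case .
  qed (use a d in simp)
  show ?thesis
  proof (rule homI)
    fix z z' assume z: "z \<in> carrier extension" and z': "z' \<in> carrier extension"
    obtain x y k where xyk: "z = ((x, y), k)"
      by (metis surj_pair)
    obtain x' y' k' where xyk': "z' = ((x', y'), k')"
      by (metis surj_pair)
    have k: "0 \<le> k" "0 \<le> k'"
      using z z' by (auto simp: xyk xyk' carrier_extension)
    define t where "t = s ^ nat k"
    have ak: "a [^]\<^bsub>K\<^esub> k \<otimes>\<^bsub>K\<^esub> b [^]\<^bsub>K\<^esub> x' = b [^]\<^bsub>K\<^esub> (t * x') \<otimes>\<^bsub>K\<^esub> a [^]\<^bsub>K\<^esub> k"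
      "a [^]\<^bsub>K\<^esub> k \<otimes>\<^bsub>K\<^esub> c [^]\<^bsub>K\<^esub> y' = c [^]\<^bsub>K\<^esub> (t * y') \<otimes>\<^bsub>K\<^esub> a [^]\<^bsub>K\<^esub> k"
      using move[OF b rel(2,5), of "nat k"] move[OF c rel(3,6), of "nat k"] k(1)
      by (simp_all add: t_def pow_nat)
    have bc: "c [^]\<^bsub>K\<^esub> y \<otimes>\<^bsub>K\<^esub> b [^]\<^bsub>K\<^esub> (t * x') = b [^]\<^bsub>K\<^esub> (t * x') \<otimes>\<^bsub>K\<^esub> c [^]\<^bsub>K\<^esub> y"
      using K.int_pow_commute[OF b c rel(4)] by simp
    have "normal_form K a b c (z \<otimes>\<^bsub>extension\<^esub> z') =
        b [^]\<^bsub>K\<^esub> (x + t * x') \<otimes>\<^bsub>K\<^esub> c [^]\<^bsub>K\<^esub> (y + t * y') \<otimes>\<^bsub>K\<^esub> a [^]\<^bsub>K\<^esub> (k + k')"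
    proof -
      have "normal_form K a b c (z \<otimes>\<^bsub>extension\<^esub> z') =
        b [^]\<^bsub>K\<^esub> ((x + t * x') mod int p) \<otimes>\<^bsub>K\<^esub> c [^]\<^bsub>K\<^esub> ((y + t * y') mod int p) \<otimes>\<^bsub>K\<^esub> a [^]\<^bsub>K\<^esub> ((k + k') mod int n)"
        using z' by (simp add: xyk xyk' mult_extension normal_form_def carrier_extension scalar_def mult_plane t_def mod_simps)
      moreover have "b [^]\<^bsub>K\<^esub> ((x + t * x') mod int p) = b [^]\<^bsub>K\<^esub> (x + t * x')"
        "c [^]\<^bsub>K\<^esub> ((y + t * y') mod int p) = c [^]\<^bsub>K\<^esub> (y + t * y')"
        "a [^]\<^bsub>K\<^esub> ((k + k') mod int n) = a [^]\<^bsub>K\<^esub> (k + k')"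
        by (intro K.int_pow_cong[OF b rel(2)] K.int_pow_cong[OF c rel(3)] K.int_pow_cong[OF a rel(1)], simp add: cong_def)+
      ultimately show ?thesis
        by simp
    qed
    also have "\<dots> = b [^]\<^bsub>K\<^esub> x \<otimes>\<^bsub>K\<^esub> (b [^]\<^bsub>K\<^esub> (t * x') \<otimes>\<^bsub>K\<^esub> c [^]\<^bsub>K\<^esub> y) \<otimes>\<^bsub>K\<^esub>
        (c [^]\<^bsub>K\<^esub> (t * y') \<otimes>\<^bsub>K\<^esub> a [^]\<^bsub>K\<^esub> k) \<otimes>\<^bsub>K\<^esub> a [^]\<^bsub>K\<^esub> k'"
      using a b c by (simp add: K.int_pow_mult K.m_assoc)
    also have "\<dots> = b [^]\<^bsub>K\<^esub> x \<otimes>\<^bsub>K\<^esub> c [^]\<^bsub>K\<^esub> y \<otimes>\<^bsub>K\<^esub> (b [^]\<^bsub>K\<^esub> (t * x') \<otimes>\<^bsub>K\<^esub> a [^]\<^bsub>K\<^esub> k) \<otimes>\<^bsub>K\<^esub> c [^]\<^bsub>K\<^esub> y' \<otimes>\<^bsub>K\<^esub> a [^]\<^bsub>K\<^esub> k'"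
      unfolding bc[symmetric] ak(2)[symmetric] using a b c by (simp add: K.m_assoc)
    also have "\<dots> = normal_form K a b c z \<otimes>\<^bsub>K\<^esub> normal_form K a b c z'"
      unfolding ak(1)[symmetric] using a b c by (simp add: normal_form_def xyk xyk' K.m_assoc)
    finally show "normal_form K a b c (z \<otimes>\<^bsub>extension\<^esub> z') =
      normal_form K a b c z \<otimes>\<^bsub>K\<^esub> normal_form K a b c z'" .
  qed (use a b c in \<open>auto simp: normal_form_def\<close>)
qed

lemma plane_pow:
  assumes "v \<in> carrier (plane p)"
  shows "(v, 0) [^]\<^bsub>extension\<^esub> (i :: int) = ((i * fst v mod int p, i * snd v mod int p), 0)"
  using hom_int_pow[OF plane_inclusion assms group_plane group_extension, of i] plane_int_pow[OF assms, of i]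
  by simp

lemma extension_satisfies_relations:
  assumes rs: "[r * s = 1] (mod int p)"
  shows "satisfies_relations extension n p r ((0, 0), 1) ((1, 0), 0) ((0, 1), 0)"
proof -
  have e: "(1, 0) \<in> carrier (plane p)" "(0, 1) \<in> carrier (plane p)"
    "\<And>x. (x mod int p, 0) \<in> carrier (plane p)" "\<And>x. (0, x mod int p) \<in> carrier (plane p)"
    "(0, 0) \<in> carrier (plane p)"
    using p_gt_1 by (simp_all add: carrier_plane)
  have rs: "(s * r) mod int p = 1"
    using rs p_gt_1 by (simp add: cong_def mult.commute)
  show ?thesis
    using e p_gt_1 n_gt_1 extension_pow[of "int n"] plane_pow[OF e(1), of "int p"] plane_pow[OF e(2), of "int p"]
    by (simp add: satisfies_relations_def plane_pow one_extension mult_extension scalar_0 mult_plane int_pow_int)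
      (simp add: scalar_def rs mod_simps e mult_plane)
qed

text \<open>The two homomorphisms come from the universal property of the presentation and from
  \<open>normal_form_hom\<close>. Both composites fix the generators, so both are identities. This shows at once
  that normal forms exhaust the presented group and that they are distinct.\<close>

lemma presented_group_iso_extension:
  assumes rs: "[r * s = 1] (mod int p)"
  shows "presented_group (relators n p r) \<cong> extension"
proof -
  note R = relators_in_free_group[of n p r]
  let ?G = "presented_group (relators n p r)" and ?\<pi> = "presented_proj (relators n p r)"
  interpret G: group ?G
    by (rule group_presented_group[OF R])
  define a b c where "a = ?\<pi> (free_gen Gen_a)" and "b = ?\<pi> (free_gen Gen_b)"
    and "c = ?\<pi> (free_gen Gen_c)"
  have abc: "a \<in> carrier ?G" "b \<in> carrier ?G" "c \<in> carrier ?G"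
    by (auto simp: a_def b_def c_def carrier_presented_group)
  have "satisfies_relations ?G n p r a b c"
    unfolding a_def b_def c_def
    using G.relators_trivial_iff[OF presented_proj_hom[OF R]] presented_proj_relator[OF R] by blast
  then have g: "normal_form ?G a b c \<in> hom extension ?G"
    using rs by (intro normal_form_hom G.is_group abc)
  define f :: "generator \<Rightarrow> (int \<times> int) \<times> int" where
    "f x = (case x of Gen_a \<Rightarrow> ((0, 0), 1) | Gen_b \<Rightarrow> ((1, 0), 0) | Gen_c \<Rightarrow> ((0, 1), 0))" for x
  have "f x \<in> carrier extension" for x
    using p_gt_1 n_gt_1 by (cases x) (simp_all add: f_def carrier_extension carrier_plane)
  then have "range f \<subseteq> carrier extension"
    by (rule image_subsetI)
  then obtain h where h: "h \<in> hom free_group extension" "\<And>x. h (free_gen x) = f x"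
    using E.free_group_universal by blast
  have "h A = \<one>\<^bsub>extension\<^esub>" if "A \<in> relators n p r" for A
    using E.relators_trivial_iff[OF h(1), of n p r] extension_satisfies_relations[OF rs] that
    by (simp add: h(2) f_def)
  then obtain \<psi> where \<psi>: "\<psi> \<in> hom ?G extension" "\<And>A. A \<in> carrier free_group \<Longrightarrow> \<psi> (?\<pi> A) = h A"
    using E.presented_group_universal[OF R h(1)] by blast
  have \<psi>_gen: "\<psi> a = ((0, 0), 1)" "\<psi> b = ((1, 0), 0)" "\<psi> c = ((0, 1), 0)"
    by (simp_all add: a_def b_def c_def \<psi>(2) h(2) f_def)
  have "normal_form ?G a b c (\<psi> A) = A" if A: "A \<in> carrier ?G" for A
  proof -
    have "(normal_form ?G a b c \<circ> \<psi>) A = id A"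
    proof (rule G.presented_group_hom_eqI[OF R Group.hom_compose[OF \<psi>(1) g]
          iso_imp_homomorphism[OF id_iso] _ A])
      show "(normal_form ?G a b c \<circ> \<psi>) (?\<pi> (free_gen x)) = id (?\<pi> (free_gen x))" for x
        using abc by (cases x)
          (simp_all add: \<psi>_gen normal_form_def flip: a_def b_def c_def)
    qed
    then show ?thesis
      by simp
  qed
  moreover have "\<psi> (normal_form ?G a b c z) = z" if z: "z \<in> carrier extension" for z
  proof -
    have e: "(1, 0) \<in> carrier (plane p)" "(0, 1) \<in> carrier (plane p)"
      using p_gt_1 by (simp_all add: carrier_plane)
    note pow = hom_int_pow[OF \<psi>(1) _ G.is_group group_extension] hom_mult[OF \<psi>(1)]
    have "(\<psi> \<circ> normal_form ?G a b c) z = id z"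
    proof (rule extension_hom_eqI[OF group_extension Group.hom_compose[OF g \<psi>(1)]
          iso_imp_homomorphism[OF id_iso] _ _ z])
      show "(\<psi> \<circ> normal_form ?G a b c) (v, 0) = id (v, 0)" if v: "v \<in> carrier (plane p)" for v
        using v abc p_gt_1
        by (cases v) (simp add: normal_form_def pow \<psi>_gen plane_pow e, simp add: mult_extension scalar_0 carrier_plane mult_plane)
      show "(\<psi> \<circ> normal_form ?G a b c) ((0, 0), 1) = id ((0, 0), 1)"
        using abc by (simp add: normal_form_def pow \<psi>_gen)
    qed
    then show ?thesis
      by simp
  qed
  ultimately have "group_isomorphisms ?G extension \<psi> (normal_form ?G a b c)"
    unfolding group_isomorphisms_def using \<psi>(1) g by blast
  then show ?thesis
    by (intro is_isoI group_isomorphisms_imp_iso)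
qed

section \<open>The automorphism group of the presented group\<close>

lemma Aut_presented_group:
  assumes rs: "[r * s = 1] (mod int p)"
  shows "AutoGroup (presented_group (relators n p r)) \<cong>
    semidirect_product (plane p) (GL 2 p) (gl_action p)"
proof -
  have "group (semidirect_product (plane p) (GL 2 p) (gl_action p))"
    using gl_action_iso[OF p_gt_1]
    by (intro group_semidirect_product group_plane group_GL p_gt_1 iso_imp_homomorphism)
  then have "AutoGroup extension \<cong> semidirect_product (plane p) (GL 2 p) (gl_action p)"
    by (rule group.iso_sym[OF _ is_isoI[OF affine_iso]])
  moreover have "AutoGroup (presented_group (relators n p r)) \<cong> AutoGroup extension"
    using presented_group_iso_extension[OF rs]
    by (intro AutoGroup_cong group_presented_group relators_in_free_group group_extension)
  ultimately show ?thesis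
    by (rule iso_trans[rotated])
qed

end

text \<open>Reduces orders of integers to orders of natural numbers, by passing to the least non-negative
  residue.\<close>

lemma ord_int_divides:
  fixes r :: int
  assumes "p > 0" and "ord (int p) r > 0"
  shows "[r ^ m = 1] (mod int p) \<longleftrightarrow> ord (int p) r dvd m"
proof -
  have coprime: "coprime (int p) r"
    using assms by (simp add: ord_def split: if_splits)
  define t where "t = nat (r mod int p)"
  have t: "int t = r mod int p"
    using assms(1) by (simp add: t_def)
  have cong: "[r ^ d = 1] (mod int p) \<longleftrightarrow> [t ^ d = 1] (mod p)" for d
  proof -
    have "[t ^ d = 1] (mod p) \<longleftrightarrow> [int t ^ d = 1] (mod int p)"
      using cong_int_iff[of "t ^ d" 1 p] by simp
    then show ?thesis
      by (simp add: t cong_def power_mod)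
  qed
  have "coprime (int p) (int t)"
    using coprime assms(1) by (simp add: t)
  then have "ord (int p) r = ord p t"
    using coprime by (simp add: ord_def cong)
  then show ?thesis
    using ord_divides[of t m p] by (simp add: cong)
qed

theorem mainTheorem11:
  fixes p q :: nat and r :: int
  assumes "prime p" and "prime q" and "p \<noteq> q"
    and "p * q \<noteq> 6"
    and "q\<^sup>2 dvd p - 1"
    and "ord (int p) r = q\<^sup>2"
  shows "\<exists>\<theta>. \<theta> \<in> hom (GL 2 p) (AutoGroup (integer_mod_group p \<times>\<times> integer_mod_group p)) \<and>
           AutoGroup (the_group p q r) \<cong>
             semidirect_product (integer_mod_group p \<times>\<times> integer_mod_group p) (GL 2 p) \<theta>"
proof -
  have q: "q\<^sup>2 > 1"
    using prime_gt_1_nat[OF assms(2)] by (intro one_less_power) simp_all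
  have order_r: "[r ^ m = 1] (mod int p) \<longleftrightarrow> q\<^sup>2 dvd m" for m
    using ord_int_divides[OF prime_gt_0_nat[OF assms(1)], of r m] q unfolding assms(6) by linarith
  \<comment> \<open>An inverse of \<open>r\<close> modulo \<open>p\<close>, of the same order.\<close>
  define s where "s = r ^ (q\<^sup>2 - 1)"
  have "r * s = r ^ Suc (q\<^sup>2 - 1)"
    by (simp add: s_def)
  also have "Suc (q\<^sup>2 - 1) = q\<^sup>2"
    using q by linarith
  finally have "r * s = r ^ q\<^sup>2" .
  then have rs: "[r * s = 1] (mod int p)"
    using order_r[of "q\<^sup>2"] by simp
  have "[s ^ m = 1] (mod int p) \<longleftrightarrow> [r ^ m = 1] (mod int p)" for m
  proof -
    have *: "[r ^ m * s ^ m = 1] (mod int p)"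
      using cong_pow[OF rs, of m] by (simp add: power_mult_distrib)
    have "[u = 1] (mod int p)" if "[u * v = 1] (mod int p)" "[v = 1] (mod int p)" for u v
      using cong_trans[OF cong_sym[OF cong_mult[OF cong_refl[of u] that(2)]] that(1)] by simp
    from this[of "r ^ m" "s ^ m"] this[of "s ^ m" "r ^ m"] * show ?thesis
      by (auto simp: mult.commute)
  qed
  moreover have "coprime p (q\<^sup>2)"
    using primes_coprime[OF assms(1,2,3)] by simp
  ultimately interpret scalar_extension p "q\<^sup>2" s
    using assms(1) q by unfold_locales (simp_all add: order_r)
  have "gl_action p \<in> hom (GL 2 p) (AutoGroup (plane p))"
    by (intro iso_imp_homomorphism gl_action_iso p_gt_1)
  then show ?thesis
    using Aut_presented_group[OF rs] unfolding the_group_eq plane_def by blast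
qed

end
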